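(* Let $k\ge 3$ and assume the sunflower conjecture holds for sunflowers with $k$ sets. Then $k$-NU-SAT admits an improved algorithm in the explicit representation model: there is a constant $c<2$ such that $\mathrm{SAT}(\mathrm{Inv}(n_k))$, with every constraint relation given as an explicit list of its tuples, can be solved in time $O^*(c^n)$ on $n$ variables.
   Context: The partial $k$-NU operation $n_k$ on $\{0,1\}$ is the $k$-ary partial operation defined exactly on tuples in which all but at most one coordinate are equal to a common value $x$, with value $x$. It is applied to tuples coordinatewise (defined iff defined in every coordinate); $R\subseteq\{0,1\}^r$ is preserved by $n_k$ if every defined application of $n_k$ to tuples of $R$ lies in $R$; $\mathrm{Inv}(n_k)$ is the set of all Boolean relations preserved by $n_k$. $\mathrm{SAT}(\Gamma)$: given variables $V$, $|V|=n$, and constraints $R(v_1,\dots,v_r)$ with $R\in\Gamma$, decide whether some $f:V\to\{0,1\}$ satisfies all constraints. A sunflower with $k$ sets is a family of $k$ sets $S_1,\dots,S_k$ such that $S_i\cap S_j = S_1\cap\dots\cap S_k$ for all $i\ne j$ (the common intersection may be empty). The sunflower conjecture for $k$ sets: there is a constant $C_k$ such that for every $n$, every family of at least $C_k^n$ distinct sets each of cardinality $n$ contains a sunflower with $k$ sets. *)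

theory Defs
  imports Complex_Main
begin

section \<open>Sunflowers\<close>

definition sunflower :: "nat \<Rightarrow> 'a set set \<Rightarrow> bool" where
  "sunflower k S \<longleftrightarrow>
     finite S \<and> card S = k \<and> (\<forall>A\<in>S. \<forall>B\<in>S. A \<noteq> B \<longrightarrow> A \<inter> B = \<Inter>S)"

text \<open>
  The case \<open>n = 0\<close> has to be excluded: the only nonempty family of empty sets has a single
  member, so it never contains \<open>k \<ge> 2\<close> distinct sets, whatever the constant \<open>C\<close>.
  Finite families of finite sets embed into \<^typ>\<open>nat set set\<close>, and an infinite family contains
  arbitrarily large finite ones, so finite families over \<^typ>\<open>nat\<close> suffice.
\<close>

definition sunflower_conjecture :: "nat \<Rightarrow> bool" where
  "sunflower_conjecture k \<longleftrightarrow>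
     (\<exists>C::real. \<forall>n\<ge>1. \<forall>F :: nat set set.
        finite F \<longrightarrow> (\<forall>A\<in>F. finite A \<and> card A = n) \<longrightarrow> C ^ n \<le> real (card F) \<longrightarrow>
        (\<exists>S\<subseteq>F. sunflower k S))"

section \<open>Partial operations and invariant relations\<close>

text \<open>
  A partial operation maps the list of its arguments to \<^const>\<open>None\<close> where it is undefined.
  A Boolean relation carries its arity, so that empty relations of different arities are distinct.
\<close>

type_synonym pop = "bool list \<Rightarrow> bool option"
type_synonym brel = "nat \<times> bool list set"

definition all_but_one :: "bool list \<Rightarrow> bool \<Rightarrow> bool" where
  "all_but_one xs x \<longleftrightarrow> card {i. i < length xs \<and> xs ! i \<noteq> x} \<le> 1"

text \<open>For \<open>k \<ge> 3\<close> the value selected by \<open>THE\<close> is unique whenever it exists.\<close>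

definition nu :: "nat \<Rightarrow> pop" where
  "nu k xs =
     (if length xs = k \<and> (\<exists>x. all_but_one xs x) then Some (THE x. all_but_one xs x) else None)"

definition preserves :: "nat \<Rightarrow> pop \<Rightarrow> brel \<Rightarrow> bool" where
  "preserves k f = (\<lambda>(r, R).
     \<forall>ts u. length ts = k \<longrightarrow> set ts \<subseteq> R \<longrightarrow> length u = r \<longrightarrow>
       (\<forall>j<r. f (map (\<lambda>t. t ! j) ts) = Some (u ! j)) \<longrightarrow> u \<in> R)"

definition Inv :: "nat \<Rightarrow> pop \<Rightarrow> brel set" where
  "Inv k f = {(r, R). R \<subseteq> {t. length t = r} \<and> preserves k f (r, R)}"

section \<open>Satisfiability with explicitly listed relations\<close>

text \<open>
  A constraint is the list of its variables together with the list of the tuples of its relation.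
  An instance is a number \<open>n\<close> of variables, named \<open>0, \<dots>, n - 1\<close>, with a list of constraints.
  Variables may be repeated within a constraint.
\<close>

type_synonym explicit_constraint = "nat list \<times> bool list list"
type_synonym explicit_instance = "nat \<times> explicit_constraint list"

definition rel_of :: "explicit_constraint \<Rightarrow> brel" where
  "rel_of = (\<lambda>(vs, ts). (length vs, set ts))"

definition SAT_instances :: "brel set \<Rightarrow> explicit_instance set" where
  "SAT_instances \<Gamma> =
     {(n, Cs). \<forall>C\<in>set Cs. set (fst C) \<subseteq> {..<n} \<and> rel_of C \<in> \<Gamma>}"

definition satisfiable :: "explicit_instance \<Rightarrow> bool" where
  "satisfiable = (\<lambda>(n, Cs).
     \<exists>f :: nat \<Rightarrow> bool. \<forall>(vs, ts)\<in>set Cs. map f vs \<in> set ts)"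

definition num_vars :: "explicit_instance \<Rightarrow> nat" where
  "num_vars = fst"

text \<open>
  The size counts each variable occurrence and each tuple entry once, independently of the way
  instances are encoded as machine inputs; the increments account for list delimiters.
\<close>

definition instance_size :: "explicit_instance \<Rightarrow> nat" where
  "instance_size = (\<lambda>(n, Cs).
     1 + n + (\<Sum>(vs, ts)\<leftarrow>Cs. (1 + length vs) * (1 + length ts)))"

section \<open>Model of computation\<close>

text \<open>
  Jones' WHILE language over binary trees (N. D. Jones, Computability and Complexity, MIT Press
  1997), with his unit-cost time measure. Tests only distinguish \<open>Nil\<close> from pairs, so
  every operation takes constant time on a machine representing trees by shared pointers.
  Conversely, \<open>T\<close> steps of a random access machine with words of \<open>O(log T)\<close> bits cost
  \<open>T\<close> times a polynomial in \<open>log T\<close> here, by keeping the memory in a search tree.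
  Bounds of the form \<open>c\<^sup>n\<close> times a polynomial in the input size are
  thus the same as for random access machines.
\<close>

datatype tree = Nil | Pair tree tree

datatype expr = Var nat | ENil | ECons expr expr | EHd expr | ETl expr

datatype com = Assign nat expr | Seq com com | If expr com com | While expr com

type_synonym state = "nat \<Rightarrow> tree"

fun tree_hd :: "tree \<Rightarrow> tree" where
  "tree_hd Nil = Nil"
| "tree_hd (Pair a b) = a"

fun tree_tl :: "tree \<Rightarrow> tree" where
  "tree_tl Nil = Nil"
| "tree_tl (Pair a b) = b"

fun eval_expr :: "expr \<Rightarrow> state \<Rightarrow> tree" where
  "eval_expr (Var x) s = s x"
| "eval_expr ENil s = Nil"
| "eval_expr (ECons e1 e2) s = Pair (eval_expr e1 s) (eval_expr e2 s)"
| "eval_expr (EHd e) s = tree_hd (eval_expr e s)"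
| "eval_expr (ETl e) s = tree_tl (eval_expr e s)"

fun cost :: "expr \<Rightarrow> nat" where
  "cost (Var x) = 1"
| "cost ENil = 1"
| "cost (ECons e1 e2) = 1 + cost e1 + cost e2"
| "cost (EHd e) = 1 + cost e"
| "cost (ETl e) = 1 + cost e"

text \<open>\<open>exec c s t s'\<close>: started in state \<open>s\<close>, command \<open>c\<close> halts in state \<open>s'\<close> after time \<open>t\<close>.\<close>

inductive exec :: "com \<Rightarrow> state \<Rightarrow> nat \<Rightarrow> state \<Rightarrow> bool" where
  Assign: "exec (Assign x e) s (1 + cost e) (s(x := eval_expr e s))"
| Seq: "exec c1 s t1 s1 \<Longrightarrow> exec c2 s1 t2 s2 \<Longrightarrow> exec (Seq c1 c2) s (t1 + t2) s2"
| IfTrue: "eval_expr e s \<noteq> Nil \<Longrightarrow> exec c1 s t s1 \<Longrightarrow> exec (If e c1 c2) s (1 + cost e + t) s1"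
| IfFalse: "eval_expr e s = Nil \<Longrightarrow> exec c2 s t s1 \<Longrightarrow> exec (If e c1 c2) s (1 + cost e + t) s1"
| WhileFalse: "eval_expr e s = Nil \<Longrightarrow> exec (While e c) s (1 + cost e) s"
| WhileTrue: "eval_expr e s \<noteq> Nil \<Longrightarrow> exec c s t1 s1 \<Longrightarrow> exec (While e c) s1 t2 s2 \<Longrightarrow>
    exec (While e c) s (1 + cost e + t1 + t2) s2"

lemma exec_deterministic:
  "exec c s t s1 \<Longrightarrow> exec c s t' s1' \<Longrightarrow> t' = t \<and> s1' = s1"
proof (induction arbitrary: t' s1' rule: exec.induct)
  case (Assign x e s)
  from Assign.prems show ?case by cases simp
next
  case (Seq c1 s t1 s1 c2 t2 s2)
  from Seq.prems show ?case by cases (metis Seq.IH)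
next
  case (IfTrue e s c1 t s1 c2)
  from IfTrue.prems show ?case by cases (use IfTrue.hyps in \<open>auto dest: IfTrue.IH\<close>)
next
  case (IfFalse e s c2 t s1 c1)
  from IfFalse.prems show ?case by cases (use IfFalse.hyps in \<open>auto dest: IfFalse.IH\<close>)
next
  case (WhileFalse e s c)
  from WhileFalse.prems show ?case by cases (use WhileFalse.hyps in auto)
next
  case step: (WhileTrue e s c t1 s1 t2 s2)
  from step.prems show ?case
  proof cases
    case (WhileTrue u1 r u2)
    then show ?thesis using step.IH by metis
  qed (use step.hyps in auto)
qed

section \<open>Encoding of instances and running time\<close>

text \<open>
  Variable names are in unary; this is at most \<open>n\<close> times longer than a binary encoding, and the
  time bound below refers to \<^const>\<open>instance_size\<close>, not to the size of the encoding.
\<close>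

fun enc_nat :: "nat \<Rightarrow> tree" where
  "enc_nat 0 = Nil"
| "enc_nat (Suc n) = Pair Nil (enc_nat n)"

definition enc_bool :: "bool \<Rightarrow> tree" where
  "enc_bool b = (if b then Pair Nil Nil else Nil)"

fun enc_list :: "('a \<Rightarrow> tree) \<Rightarrow> 'a list \<Rightarrow> tree" where
  "enc_list enc [] = Nil"
| "enc_list enc (x # xs) = Pair (enc x) (enc_list enc xs)"

definition enc_constraint :: "explicit_constraint \<Rightarrow> tree" where
  "enc_constraint = (\<lambda>(vs, ts). Pair (enc_list enc_nat vs) (enc_list (enc_list enc_bool) ts))"

definition enc_instance :: "explicit_instance \<Rightarrow> tree" where
  "enc_instance = (\<lambda>(n, Cs). Pair (enc_nat n) (enc_list enc_constraint Cs))"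

text \<open>Input and output are in variable 0, all other variables are initially \<open>Nil\<close>.\<close>

definition init_state :: "tree \<Rightarrow> state" where
  "init_state d = (\<lambda>_. Nil)(0 := d)"

definition decides_within ::
  "com \<Rightarrow> explicit_instance set \<Rightarrow> (explicit_instance \<Rightarrow> real) \<Rightarrow> bool" where
  "decides_within P X T \<longleftrightarrow>
     (\<forall>I\<in>X. \<exists>t s. exec P (init_state (enc_instance I)) t s \<and>
        (s 0 \<noteq> Nil \<longleftrightarrow> satisfiable I) \<and> real t \<le> T I)"

text \<open>
  Time \<open>O\<^sup>*(c\<^sup>n)\<close>: as usual the factor suppressed is polynomial in the input size.
\<close>

definition explicit_SAT_solvable_in_O_star :: "brel set \<Rightarrow> real \<Rightarrow> bool" where
  "explicit_SAT_solvable_in_O_star \<Gamma> c \<longleftrightarrow>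
     (\<exists>P (a::nat) (d::nat). decides_within P (SAT_instances \<Gamma>)
        (\<lambda>I. real (a * instance_size I ^ d) * c ^ num_vars I))"

end

theory Submission imports Defs begin

text \<open>
  Local search around the words of a covering code. Let \<open>a\<close> be an assignment violating a constraint
  whose relation is preserved by \<open>n\<^sub>k\<close>, and consider the inclusion-minimal sets of variables whose flip
  repairs the constraint. If \<open>k\<close> such sets formed a sunflower, applying \<open>n\<^sub>k\<close> to the corresponding tuples
  would show that flipping only the core repairs the constraint, against minimality. So at most
  \<open>c ^ d\<close> of these sets have size \<open>d\<close>. Every satisfying assignment differs from \<open>a\<close> on some minimal set;
  branching over them searches the Hamming ball of radius \<open>\<rho>\<close> around \<open>a\<close> with a search tree of at most
  \<open>(2 * c) ^ \<rho>\<close> nodes.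

  Cut the variables into blocks of length \<open>b\<close> and take as centres the concatenations of words of
  a code of length \<open>b\<close> and covering radius 1. With \<open>M\<close> code words, \<open>(M * 2 * c) ^ (n / b)\<close> nodes
  suffice up to lower-order terms. As \<open>M\<close> can be made an arbitrarily small fraction of \<open>2 ^ b\<close>
  by choosing \<open>b\<close> large, the base \<open>(M * 2 * c) powr (1 / b)\<close> drops below 2.
\<close>

section \<open>Polynomial-time tree functions\<close>

text \<open>The sunflower constant may be huge, so a search costing \<open>(2 * c) ^ \<rho>\<close>
  pays off only if the radius is a small fraction of the number of variables. This is why the block
  length has to depend on \<open>c\<close>. The factor 2 makes the count close: a node of budget
  \<open>\<rho>\<close> has at most \<open>c ^ d\<close> children of budget
  \<open>\<rho> - d\<close>, and the sum of \<open>c ^ d * (2 * c) ^ (\<rho> - d)\<close> over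
  \<open>1 \<le> d \<le> \<rho>\<close> is \<open>c ^ \<rho> * (2 ^ \<rho> - 1)\<close>, which
  leaves room for the node itself. Explicit lists matter because every way of repairing a constraint
  is given by one of its tuples, so the minimal sets are found in polynomial time by comparing
  tuples. The centres are never stored: choosing the code word of the next block is one more
  branching step of the same search tree, and it raises the budget by 1. WHILE programs have no
  recursion, so the tree is traversed with an explicit stack. The work at a node is a single tree
  function whose polynomial running time follows from closure properties, without its program being
  written out.\<close>

fun tsize :: "tree \<Rightarrow> nat" where
  "tsize Nil = 1"
| "tsize (Pair a b) = 1 + tsize a + tsize b"

lemma tsize_pos [simp]: "0 < tsize x" "tsize x \<noteq> 0" "Suc 0 \<le> tsize x"
  by (induction x) auto

lemma tsize_hd_tl: "tsize (tree_hd x) \<le> tsize x" "tsize (tree_tl x) \<le> tsize x"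
  "tsize (tree_hd x) + tsize (tree_tl x) \<le> Suc (tsize x)"
  by (cases x; simp)+

text \<open>As \<open>1 + tsize x\<close> is at least 2, constant factors are absorbed into the
  exponent, so a single number \<open>c\<close> describes any polynomial bound.\<close>

definition poly_bounded :: "(tree \<Rightarrow> nat) \<Rightarrow> bool" where
  "poly_bounded g \<longleftrightarrow> (\<exists>c. \<forall>x. g x \<le> (1 + tsize x) ^ c)"

lemma poly_bounded_mono: "poly_bounded g \<Longrightarrow> (\<And>x. f x \<le> g x) \<Longrightarrow> poly_bounded f"
  unfolding poly_bounded_def by (meson le_trans)

lemma poly_bounded_const [intro]: "poly_bounded (\<lambda>_. k)"
proof -
  have "k \<le> (1 + tsize x) ^ k" for x
  proof -
    have "k \<le> 2 ^ k" by simp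
    also have "\<dots> \<le> (1 + tsize x) ^ k" by (rule power_mono) (auto simp: Suc_le_eq)
    finally show ?thesis .
  qed
  then show ?thesis unfolding poly_bounded_def by blast
qed

lemma poly_bounded_tsize [intro]: "poly_bounded tsize"
  unfolding poly_bounded_def by (rule exI[of _ 1]) simp

lemma poly_bounded_mult [intro]:
  assumes "poly_bounded f" "poly_bounded g"
  shows "poly_bounded (\<lambda>x. f x * g x)"
proof -
  obtain c d where c: "\<And>x. f x \<le> (1 + tsize x) ^ c" and d: "\<And>x. g x \<le> (1 + tsize x) ^ d"
    using assms unfolding poly_bounded_def by blast
  have "f x * g x \<le> (1 + tsize x) ^ (c + d)" for x
    unfolding power_add by (intro mult_mono c d) auto
  then show ?thesis unfolding poly_bounded_def by blast
qed

lemma poly_bounded_add [intro]: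
  assumes "poly_bounded f" "poly_bounded g"
  shows "poly_bounded (\<lambda>x. f x + g x)"
proof -
  \<comment> \<open>The product dominates the sum, which reduces addition to
    \<open>poly_bounded_mult\<close> and the case of adding 1.\<close>
  have "poly_bounded (\<lambda>x. (1 + f x) * (1 + g x))"
  proof -
    have "poly_bounded (\<lambda>x. 1 + h x)" if h: "poly_bounded h" for h
    proof -
      obtain c where c: "\<And>x. h x \<le> (1 + tsize x) ^ c"
        using h unfolding poly_bounded_def by blast
      have "1 + h x \<le> (1 + tsize x) ^ Suc c" for x
      proof -
        have "1 + h x \<le> (1 + tsize x) ^ c + (1 + tsize x) ^ c"
          by (intro add_mono c) auto
        also have "\<dots> \<le> (1 + tsize x) ^ Suc c"
          using tsize_pos(3)[of x] by (simp add: Suc_le_eq)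
        finally show ?thesis .
      qed
      then show ?thesis unfolding poly_bounded_def by blast
    qed
    then show ?thesis using assms by (intro poly_bounded_mult) auto
  qed
  then show ?thesis by (rule poly_bounded_mono) (simp add: algebra_simps)
qed

lemma poly_bounded_comp:
  assumes "poly_bounded g" "poly_bounded (\<lambda>x. tsize (f x))"
  shows "poly_bounded (\<lambda>x. g (f x))"
proof -
  have p: "poly_bounded (\<lambda>x. (1 + tsize (f x)) ^ c)" for c
    by (induction c) (use assms in auto)
  obtain c where c: "\<And>x. g x \<le> (1 + tsize x) ^ c"
    using assms unfolding poly_bounded_def by blast
  show ?thesis by (rule poly_bounded_mono[OF p[of c]]) (rule c)
qed

text \<open>
  Quantifying over the base \<open>N\<close> makes programs relocatable: a subroutine placed at a base above
  all live variables clobbers none of them. The size of the result has to be bounded separately,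
  as a program can build trees with shared subtrees that are exponentially larger than its
  running time.
\<close>

definition computes_within :: "(nat \<Rightarrow> com) \<Rightarrow> (tree \<Rightarrow> tree) \<Rightarrow> (tree \<Rightarrow> nat) \<Rightarrow> bool" where
  "computes_within c f T \<longleftrightarrow>
    (\<forall>N s. \<exists>t s'. exec (c N) s t s' \<and> s' N = f (s N) \<and> (\<forall>i<N. s' i = s i) \<and> t \<le> T (s N))"

definition ptime :: "(tree \<Rightarrow> tree) \<Rightarrow> bool" where
  "ptime f \<longleftrightarrow> poly_bounded (\<lambda>x. tsize (f x)) \<and> (\<exists>c T. poly_bounded T \<and> computes_within c f T)"

lemma computes_withinE:
  assumes "computes_within c f T"
  obtains t s' where "exec (c N) s t s'" "s' N = f (s N)" "\<forall>i<N. s' i = s i" "t \<le> T (s N)"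
  using assms unfolding computes_within_def by blast

lemma ptime_size: "ptime f \<Longrightarrow> poly_bounded (\<lambda>x. tsize (f x))"
  by (simp add: ptime_def)

lemma ptimeE:
  assumes "ptime f"
  obtains T c where "poly_bounded T" "computes_within c f T"
  using assms unfolding ptime_def by blast

lemma ptimeI:
  assumes "poly_bounded (\<lambda>x. tsize (f x))" "poly_bounded T"
    and "\<And>N s. \<exists>t s'. exec (c N) s t s' \<and> s' N = f (s N) \<and> (\<forall>i<N. s' i = s i) \<and> t \<le> T (s N)"
  shows "ptime f"
  using assms unfolding ptime_def computes_within_def by blast

lemma exec_AssignI: "t = 1 + cost e \<Longrightarrow> s' = s(x := eval_expr e s) \<Longrightarrow> exec (Assign x e) s t s'"
  using exec.Assign by simp

lemma ptime_expr:
  assumes "poly_bounded (\<lambda>x. tsize (f x))" "\<And>N s. eval_expr (e N) s = f (s N)" "\<And>N. cost (e N) \<le> K"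
  shows "ptime f"
proof (rule ptimeI[where T = "\<lambda>_. 1 + K" and c = "\<lambda>N. Assign N (e N)"])
  fix N :: nat and s :: state
  show "\<exists>t s'. exec (Assign N (e N)) s t s' \<and> s' N = f (s N) \<and> (\<forall>i<N. s' i = s i) \<and> t \<le> 1 + K"
    by (intro exI conjI, rule exec.Assign) (use assms in auto)
qed (use assms in auto)

lemma ptime_id: "ptime (\<lambda>x. x)"
  by (rule ptime_expr[where e = Var and K = 1]) auto

lemma ptime_compose:
  assumes "ptime f" "ptime g"
  shows "ptime (\<lambda>x. f (g x))"
proof -
  obtain T c where T: "poly_bounded T" and c: "computes_within c f T"
    using assms(1) by (rule ptimeE)
  obtain U d where U: "poly_bounded U" and d: "computes_within d g U"
    using assms(2) by (rule ptimeE)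
  show ?thesis
  proof (rule ptimeI[where T = "\<lambda>x. U x + T (g x)" and c = "\<lambda>N. Seq (d N) (c N)"])
    fix N :: nat and s :: state
    obtain t1 s1 where 1: "exec (d N) s t1 s1" "s1 N = g (s N)" "\<forall>i<N. s1 i = s i" "t1 \<le> U (s N)"
      by (rule computes_withinE[OF d])
    obtain t2 s2 where 2: "exec (c N) s1 t2 s2" "s2 N = f (s1 N)" "\<forall>i<N. s2 i = s1 i" "t2 \<le> T (s1 N)"
      by (rule computes_withinE[OF c])
    show "\<exists>t s'. exec (Seq (d N) (c N)) s t s' \<and> s' N = f (g (s N)) \<and> (\<forall>i<N. s' i = s i) \<and>
        t \<le> U (s N) + T (g (s N))"
      by (intro exI conjI, rule exec.Seq[OF 1(1) 2(1)]) (use 1 2 in auto)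
  qed (rule poly_bounded_comp[OF ptime_size[OF assms(1)] ptime_size[OF assms(2)]],
      rule poly_bounded_add[OF U poly_bounded_comp[OF T ptime_size[OF assms(2)]]])
qed

lemma ptime_Nil: "ptime (\<lambda>_. Nil)"
  by (rule ptime_expr[where e = "\<lambda>_. ENil" and K = 1]) auto

lemma ptime_hd: "ptime f \<Longrightarrow> ptime (\<lambda>x. tree_hd (f x))"
  by (rule ptime_compose[where f = tree_hd], rule ptime_expr[where e = "\<lambda>N. EHd (Var N)" and K = 2])
    (auto intro: poly_bounded_mono[OF poly_bounded_tsize] tsize_hd_tl)

lemma ptime_tl: "ptime f \<Longrightarrow> ptime (\<lambda>x. tree_tl (f x))"
  by (rule ptime_compose[where f = tree_tl], rule ptime_expr[where e = "\<lambda>N. ETl (Var N)" and K = 2])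
    (auto intro: poly_bounded_mono[OF poly_bounded_tsize] tsize_hd_tl)

text \<open>Running \<open>f\<close> at base \<open>N+1\<close> leaves the input in \<open>N\<close>
  intact, and running \<open>g\<close> at base \<open>N+2\<close> leaves both the input and the
  result of \<open>f\<close> intact.\<close>

lemma ptime_Pair:
  assumes "ptime f" "ptime g"
  shows "ptime (\<lambda>x. Pair (f x) (g x))"
proof -
  obtain T c where T: "poly_bounded T" and c: "computes_within c f T"
    using assms(1) by (rule ptimeE)
  obtain U d where U: "poly_bounded U" and d: "computes_within d g U"
    using assms(2) by (rule ptimeE)
  let ?p = "\<lambda>N. Seq (Assign (N+1) (Var N)) (Seq (c (N+1)) (Seq (Assign (N+2) (Var N)) (Seq (d (N+2))
      (Assign N (ECons (Var (N+1)) (Var (N+2)))))))"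
  show ?thesis
  proof (rule ptimeI[where T = "\<lambda>x. 8 + T x + U x" and c = ?p])
    fix N :: nat and s :: state
    let ?s0 = "s(N+1 := s N)"
    obtain t1 s1 where 1: "exec (c (N+1)) ?s0 t1 s1" "s1 (N+1) = f (?s0 (N+1))"
      "\<forall>i<N+1. s1 i = ?s0 i" "t1 \<le> T (?s0 (N+1))"
      by (rule computes_withinE[OF c])
    let ?s1 = "s1(N+2 := s1 N)"
    obtain t2 s2 where 2: "exec (d (N+2)) ?s1 t2 s2" "s2 (N+2) = g (?s1 (N+2))"
      "\<forall>i<N+2. s2 i = ?s1 i" "t2 \<le> U (?s1 (N+2))"
      by (rule computes_withinE[OF d])
    have e1: "exec (Assign (N+1) (Var N)) s 2 ?s0" by (rule exec_AssignI) auto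
    have e2: "exec (Assign (N+2) (Var N)) s1 2 ?s1" by (rule exec_AssignI) auto
    show "\<exists>t s'. exec (?p N) s t s' \<and> s' N = Pair (f (s N)) (g (s N)) \<and> (\<forall>i<N. s' i = s i) \<and>
        t \<le> 8 + T (s N) + U (s N)"
      by (intro exI conjI, rule exec.Seq[OF e1 exec.Seq[OF 1(1) exec.Seq[OF e2 exec.Seq[OF 2(1) exec.Assign]]]])
        (use 1 2 in auto)
  next
    have "poly_bounded (\<lambda>x. 1 + tsize (f x) + tsize (g x))"
      using assms by (intro poly_bounded_add poly_bounded_const ptime_size)
    then show "poly_bounded (\<lambda>x. tsize (Pair (f x) (g x)))" by simp
  qed (intro poly_bounded_add T U poly_bounded_const)
qed

text \<open>Programs are unary, so several arguments travel as a right-nested pair; the rule passes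
  from the paired form to the curried function applied to arbitrary \<open>ptime\<close>
  arguments.\<close>

lemma ptime_compose2:
  assumes "ptime (\<lambda>p. F (tree_hd p) (tree_tl p))" "ptime f" "ptime g"
  shows "ptime (\<lambda>x. F (f x) (g x))"
  using ptime_compose[OF assms(1) ptime_Pair[OF assms(2,3)]] by simp

lemma ptime_compose3:
  assumes "ptime (\<lambda>p. F (tree_hd p) (tree_hd (tree_tl p)) (tree_tl (tree_tl p)))"
    "ptime f" "ptime g" "ptime h"
  shows "ptime (\<lambda>x. F (f x) (g x) (h x))"
  using ptime_compose[OF assms(1) ptime_Pair[OF assms(2) ptime_Pair[OF assms(3,4)]]] by simp

lemma ptime_if_Nil:
  assumes "ptime p" "ptime f" "ptime g"
  shows "ptime (\<lambda>x. if p x = Nil then g x else f x)"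
proof -
  obtain R b where R: "poly_bounded R" and b: "computes_within b p R"
    using assms(1) by (rule ptimeE)
  obtain T c where T: "poly_bounded T" and c: "computes_within c f T"
    using assms(2) by (rule ptimeE)
  obtain U d where U: "poly_bounded U" and d: "computes_within d g U"
    using assms(3) by (rule ptimeE)
  let ?p = "\<lambda>N. Seq (Assign (N+1) (Var N)) (Seq (b (N+1)) (If (Var (N+1)) (c N) (d N)))"
  show ?thesis
  proof (rule ptimeI[where T = "\<lambda>x. 4 + R x + T x + U x" and c = ?p])
    fix N :: nat and s :: state
    let ?s0 = "s(N+1 := s N)"
    have e1: "exec (Assign (N+1) (Var N)) s 2 ?s0" by (rule exec_AssignI) auto
    obtain t1 s1 where 1: "exec (b (N+1)) ?s0 t1 s1" "s1 (N+1) = p (?s0 (N+1))"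
      "\<forall>i<N+1. s1 i = ?s0 i" "t1 \<le> R (?s0 (N+1))"
      by (rule computes_withinE[OF b])
    show "\<exists>t s'. exec (?p N) s t s' \<and> s' N = (if p (s N) = Nil then g (s N) else f (s N)) \<and>
        (\<forall>i<N. s' i = s i) \<and> t \<le> 4 + R (s N) + T (s N) + U (s N)"
    proof (cases "p (s N) = Nil")
      case True
      obtain t2 s2 where 2: "exec (d N) s1 t2 s2" "s2 N = g (s1 N)" "\<forall>i<N. s2 i = s1 i" "t2 \<le> U (s1 N)"
        by (rule computes_withinE[OF d])
      have "eval_expr (Var (N+1)) s1 = Nil" using True 1 by simp
      from exec.IfFalse[OF this 2(1)] show ?thesis
        by (intro exI conjI, rule exec.Seq[OF e1 exec.Seq[OF 1(1)]]) (use 1 2 True in auto)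
    next
      case False
      obtain t2 s2 where 2: "exec (c N) s1 t2 s2" "s2 N = f (s1 N)" "\<forall>i<N. s2 i = s1 i" "t2 \<le> T (s1 N)"
        by (rule computes_withinE[OF c])
      have "eval_expr (Var (N+1)) s1 \<noteq> Nil" using False 1 by simp
      from exec.IfTrue[OF this 2(1)] show ?thesis
        by (intro exI conjI, rule exec.Seq[OF e1 exec.Seq[OF 1(1)]]) (use 1 2 False in auto)
    qed
  next
    show "poly_bounded (\<lambda>x. tsize (if p x = Nil then g x else f x))"
      by (rule poly_bounded_mono[OF poly_bounded_add[OF assms(2,3)[THEN ptime_size]]]) auto
  qed (intro poly_bounded_add R T U poly_bounded_const)
qed

section \<open>Booleans and list folds in polynomial time\<close>

definition ptest :: "(tree \<Rightarrow> bool) \<Rightarrow> bool" where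
  "ptest P \<longleftrightarrow> ptime (\<lambda>x. enc_bool (P x))"

lemma enc_bool_simps [simp]: "enc_bool True = Pair Nil Nil" "enc_bool False = Nil"
  "enc_bool b = Nil \<longleftrightarrow> \<not> b" "tsize (enc_bool b) \<le> 3"
  by (auto simp: enc_bool_def)

lemma ptime_enc_bool: "ptest P \<Longrightarrow> ptime (\<lambda>x. enc_bool (P x))"
  by (simp add: ptest_def)

lemma ptime_if:
  assumes "ptest P" "ptime f" "ptime g"
  shows "ptime (\<lambda>x. if P x then f x else g x)"
proof -
  have "ptime (\<lambda>x. if enc_bool (P x) = Nil then g x else f x)"
    using assms by (intro ptime_if_Nil ptime_enc_bool)
  moreover have "(\<lambda>x. if enc_bool (P x) = Nil then g x else f x) = (\<lambda>x. if P x then f x else g x)"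
    by auto
  ultimately show ?thesis by metis
qed

lemma ptest_const: "ptest (\<lambda>_. b)"
  by (cases b) (auto simp: ptest_def intro: ptime_Pair ptime_Nil)

lemma ptest_if:
  assumes "ptest P" "ptest Q" "ptest R"
  shows "ptest (\<lambda>x. if P x then Q x else R x)"
proof -
  have "ptime (\<lambda>x. if P x then enc_bool (Q x) else enc_bool (R x))"
    using assms by (intro ptime_if ptime_enc_bool)
  moreover have "(\<lambda>x. if P x then enc_bool (Q x) else enc_bool (R x)) =
      (\<lambda>x. enc_bool (if P x then Q x else R x))"
    by auto
  ultimately show ?thesis unfolding ptest_def by metis
qed

lemma ptest_not: "ptest P \<Longrightarrow> ptest (\<lambda>x. \<not> P x)"
  using ptest_if[OF _ ptest_const[of False] ptest_const[of True], of P] by (simp add: if_bool_eq_conj)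

lemma ptest_conj: "ptest P \<Longrightarrow> ptest Q \<Longrightarrow> ptest (\<lambda>x. P x \<and> Q x)"
  using ptest_if[OF _ _ ptest_const[of False], of P Q] by (simp add: if_bool_eq_disj)

lemma ptest_disj: "ptest P \<Longrightarrow> ptest Q \<Longrightarrow> ptest (\<lambda>x. P x \<or> Q x)"
  using ptest_not[OF ptest_conj[OF ptest_not ptest_not], of P Q] by simp

lemma ptest_Nil:
  assumes "ptime f"
  shows "ptest (\<lambda>x. f x = Nil)"
proof -
  have "(\<lambda>x. if f x = Nil then Pair Nil Nil else Nil) = (\<lambda>x. enc_bool (f x = Nil))"
    by (auto simp: enc_bool_def)
  moreover have "ptime (\<lambda>x. if f x = Nil then Pair Nil Nil else Nil)"
    by (intro ptime_if_Nil assms ptime_Pair ptime_Nil)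
  ultimately show ?thesis by (simp add: ptest_def)
qed

text \<open>Every tree is read as the list of the left subtrees along its right spine, so list
  functions are total on trees and no well-formedness condition enters \<open>ptime\<close>.\<close>

fun tfold :: "(tree \<Rightarrow> tree \<Rightarrow> tree) \<Rightarrow> tree \<Rightarrow> tree \<Rightarrow> tree" where
  "tfold h Nil a = a"
| "tfold h (Pair x xs) a = tfold h xs (h x a)"

fun tlen :: "tree \<Rightarrow> nat" where
  "tlen Nil = 0"
| "tlen (Pair x xs) = Suc (tlen xs)"

fun tset :: "tree \<Rightarrow> tree set" where
  "tset Nil = {}"
| "tset (Pair x xs) = insert x (tset xs)"

lemma tlen_less_tsize: "tlen x < tsize x"
  by (induction x) auto

lemma tset_tsize: "x \<in> tset xs \<Longrightarrow> tsize x < tsize xs"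
  by (induction xs) auto

text \<open>
  The step function may enlarge the accumulator only by an amount independent of the accumulator;
  otherwise iterated doubling would be allowed.
\<close>

lemma ptime_tfold:
  assumes h: "ptime (\<lambda>p. h (tree_hd p) (tree_hd (tree_tl p)) (tree_tl (tree_tl p)))"
    and growth: "poly_bounded q" "\<And>x a e. tsize (h x a e) \<le> tsize a + q (Pair x e)"
    and L: "ptime L" and A: "ptime A"
  shows "ptime (\<lambda>e. tfold (\<lambda>x a. h x a e) (L e) (A e))"
proof -
  obtain w where w: "\<And>x. q x \<le> (1 + tsize x) ^ w"
    using growth(1) unfolding poly_bounded_def by blast
  obtain T c where T: "poly_bounded T" and c: "computes_within c (\<lambda>p. h (tree_hd p) (tree_hd (tree_tl p)) (tree_tl (tree_tl p))) T"
    using h by (rule ptimeE)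
  obtain v where v: "\<And>x. T x \<le> (1 + tsize x) ^ v"
    using T unfolding poly_bounded_def by blast
  obtain U d where U: "poly_bounded U" and d: "computes_within d L U"
    using L by (rule ptimeE)
  obtain V a where V: "poly_bounded V" and a: "computes_within a A V"
    using A by (rule ptimeE)
  \<comment> \<open>Layout: \<open>N\<close> holds the environment, \<open>N+1\<close> the rest of
    the list, \<open>N+2\<close> the accumulator, and \<open>N+3\<close> the argument and the result
    of the step.\<close>
  let ?b = "\<lambda>N. Seq (Assign (N+3) (ECons (EHd (Var (N+1))) (ECons (Var (N+2)) (Var N)))) (Seq (c (N+3))
     (Seq (Assign (N+2) (Var (N+3))) (Assign (N+1) (ETl (Var (N+1))))))"
  let ?Q = "\<lambda>xs e. (1 + (1 + tsize xs + tsize e)) ^ w"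
  have size: "tsize (tfold (\<lambda>x a. h x a e) xs y) \<le> tsize y + tlen xs * M"
    if "\<And>x. x \<in> tset xs \<Longrightarrow> q (Pair x e) \<le> M" for xs y e M
    using that
  proof (induction xs arbitrary: y)
    case (Pair x xs)
    have "tsize (tfold (\<lambda>x a. h x a e) xs (h x y e)) \<le> tsize (h x y e) + tlen xs * M"
      using Pair by auto
    also have "\<dots> \<le> tsize y + q (Pair x e) + tlen xs * M" using growth(2) by simp
    also have "\<dots> \<le> tsize y + M + tlen xs * M" using Pair.prems[of x] by simp
    finally show ?case by (simp add: algebra_simps)
  qed simp
  have qQ: "q (Pair x e) \<le> ?Q xs e" if "x \<in> tset xs" for x xs e
  proof -
    have "q (Pair x e) \<le> (1 + tsize (Pair x e)) ^ w" by (rule w)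
    also have "\<dots> \<le> ?Q xs e" by (rule power_mono) (use tset_tsize[OF that] in auto)
    finally show ?thesis .
  qed
  \<comment> \<open>\<open>M\<close> bounds the growth per step, \<open>Z\<close> the list elements,
    and \<open>Y\<close> the accumulator throughout, the second assumption being a loop invariant.
    Hence every call of the step sees an argument of size at most
    \<open>2 + Z + Y + tsize (s N)\<close>.\<close>
  have loop: "\<exists>t s'. exec (While (Var (N+1)) (?b N)) s t s' \<and>
      s' (N+2) = tfold (\<lambda>x a. h x a (s N)) (s (N+1)) (s (N+2)) \<and>
      (\<forall>i\<le>N. s' i = s i) \<and> t \<le> 2 + tlen (s (N+1)) * (20 + (1 + (2 + Z + Y + tsize (s N))) ^ v)"
    if "\<And>x. x \<in> tset (s (N+1)) \<Longrightarrow> q (Pair x (s N)) \<le> M \<and> tsize x \<le> Z"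
      and "tsize (s (N+2)) + tlen (s (N+1)) * M \<le> Y" for N s M Z Y
    using that
  proof (induction "s (N+1)" arbitrary: s)
    case Nil
    show ?case
      by (intro exI conjI, rule exec.WhileFalse) (use Nil in auto)
  next
    case (Pair x xs)
    let ?y = "s (N+2)" and ?e = "s N"
    have sN: "s (N+1) = Pair x xs" "s (Suc N) = Pair x xs" using Pair.hyps(3) by simp_all
    let ?s0 = "s(N+3 := Pair x (Pair ?y ?e))"
    have e1: "exec (Assign (N+3) (ECons (EHd (Var (N+1))) (ECons (Var (N+2)) (Var N)))) s 7 ?s0"
      by (rule exec_AssignI) (auto simp: sN)
    obtain t1 s1 where 1: "exec (c (N+3)) ?s0 t1 s1" "s1 (N+3) = h x ?y ?e"
      "\<forall>i<N+3. s1 i = ?s0 i" "t1 \<le> T (Pair x (Pair ?y ?e))"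
      by (rule computes_withinE[OF c, of "N+3" ?s0]) auto
    let ?s1 = "s1(N+2 := h x ?y ?e)"
    have e2: "exec (Assign (N+2) (Var (N+3))) s1 2 ?s1"
       by (rule exec_AssignI) (use 1 in \<open>auto simp: sN\<close>)
    let ?s2 = "?s1(N+1 := xs)"
    have e3: "exec (Assign (N+1) (ETl (Var (N+1)))) ?s1 3 ?s2"
       by (rule exec_AssignI) (use 1 in \<open>auto simp: sN\<close>)
    have body: "exec (?b N) s (7 + (t1 + (2 + 3))) ?s2"
      by (rule exec.Seq[OF e1 exec.Seq[OF 1(1) exec.Seq[OF e2 e3]]])
    have s2: "?s2 N = ?e" "?s2 (N+1) = xs" "?s2 (N+2) = h x ?y ?e" "\<forall>i\<le>N. ?s2 i = s i"
      using 1 by auto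
    have M: "q (Pair x ?e) \<le> M" "tsize x \<le> Z" using Pair.prems(1)[of x] by (auto simp: sN)
    have Y: "tsize (h x ?y ?e) + tlen xs * M \<le> Y"
      using Pair.prems(2) M growth(2)[of x ?y ?e] by (simp add: sN)
    have yY: "tsize ?y \<le> Y" using Pair.prems(2) by simp
    obtain t2 s3 where 2: "exec (While (Var (N+1)) (?b N)) ?s2 t2 s3"
      "s3 (N+2) = tfold (\<lambda>x a. h x a ?e) xs (h x ?y ?e)" "\<forall>i\<le>N. s3 i = ?s2 i"
      "t2 \<le> 2 + tlen xs * (20 + (1 + (2 + Z + Y + tsize ?e)) ^ v)"
      using Pair.hyps(2)[of ?s2] s2 Pair.prems(1) Y unfolding sN by auto
    have "eval_expr (Var (N+1)) s \<noteq> Nil" by (simp add: sN)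
    note exec.WhileTrue[OF this body 2(1)]
    moreover have "s3 (N+2) = tfold (\<lambda>x a. h x a (s N)) (s (N+1)) (s (N+2))"
      using 2 by (simp add: sN)
    moreover have "\<forall>i\<le>N. s3 i = s i" using 2(3) s2(4) by simp
    moreover have "1 + cost (Var (N+1)) + (7 + (t1 + (2 + 3))) + t2
        \<le> 2 + tlen (s (N+1)) * (20 + (1 + (2 + Z + Y + tsize ?e)) ^ v)"
    proof -
      have "t1 \<le> (1 + tsize (Pair x (Pair ?y ?e))) ^ v" using 1(4) v le_trans by blast
      also have "\<dots> \<le> (1 + (2 + Z + Y + tsize ?e)) ^ v" by (rule power_mono) (use M yY in auto)
      finally show ?thesis using 2(4) by (simp add: sN)
    qed
    ultimately show ?case by blast
  qed
  let ?p = "\<lambda>N. Seq (Assign (N+1) (Var N)) (Seq (d (N+1)) (Seq (Assign (N+2) (Var N)) (Seq (a (N+2))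
      (Seq (While (Var (N+1)) (?b N)) (Assign N (Var (N+2)))))))"
  let ?Y = "\<lambda>e. tsize (A e) + tlen (L e) * ?Q (L e) e"
  let ?T = "\<lambda>e. 8 + U e + V e + tlen (L e) * (20 + (1 + (2 + tsize (L e) + ?Y e + tsize e)) ^ v)"
  have pw: "poly_bounded (\<lambda>x. f x ^ n)" if "poly_bounded f" for f n
    by (induction n) (use that in auto)
  have pL: "poly_bounded (\<lambda>e. tlen (L e))"
    by (rule poly_bounded_mono[OF ptime_size[OF L]]) (simp add: tlen_less_tsize less_imp_le)
  have pY: "poly_bounded ?Y"
    by (intro poly_bounded_add poly_bounded_mult pw poly_bounded_const poly_bounded_tsize pL ptime_size L A)
  have pT: "poly_bounded ?T"
    by (intro poly_bounded_add poly_bounded_mult pw poly_bounded_const poly_bounded_tsize pL ptime_size L A U V)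
  show ?thesis
  proof (rule ptimeI[where T = ?T and c = ?p])
    show "poly_bounded (\<lambda>e. tsize (tfold (\<lambda>x a. h x a e) (L e) (A e)))"
      by (rule poly_bounded_mono[OF pY], rule size) (rule qQ)
    show "poly_bounded ?T" by (rule pT)
    fix N :: nat and s :: state
    let ?e = "s N"
    let ?s0 = "s(N+1 := ?e)"
    have e1: "exec (Assign (N+1) (Var N)) s 2 ?s0" by (rule exec_AssignI) auto
    obtain t1 s1 where 1: "exec (d (N+1)) ?s0 t1 s1" "s1 (N+1) = L (?s0 (N+1))"
      "\<forall>i<N+1. s1 i = ?s0 i" "t1 \<le> U (?s0 (N+1))"
      by (rule computes_withinE[OF d])
    let ?s1 = "s1(N+2 := s1 N)"
    have e2: "exec (Assign (N+2) (Var N)) s1 2 ?s1" by (rule exec_AssignI) auto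
    obtain t2 s2 where 2: "exec (a (N+2)) ?s1 t2 s2" "s2 (N+2) = A (?s1 (N+2))"
      "\<forall>i<N+2. s2 i = ?s1 i" "t2 \<le> V (?s1 (N+2))"
      by (rule computes_withinE[OF a])
    have s2: "s2 N = ?e" "s2 (N+1) = L ?e" "s2 (N+2) = A ?e" "\<forall>i\<le>N. s2 i = s i"
      using 1 2 by auto
    obtain t3 s3 where 3: "exec (While (Var (N+1)) (?b N)) s2 t3 s3"
      "s3 (N+2) = tfold (\<lambda>x a. h x a ?e) (L ?e) (A ?e)" "\<forall>i\<le>N. s3 i = s2 i"
      "t3 \<le> 2 + tlen (L ?e) * (20 + (1 + (2 + tsize (L ?e) + ?Y ?e + tsize ?e)) ^ v)"
      using loop[of s2 N "?Q (L ?e) ?e" "tsize (L ?e)" "?Y ?e"] qQ[of _ "L ?e" ?e] tset_tsize[of _ "L ?e"]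
      unfolding s2 by (auto simp: less_imp_le)
    show "\<exists>t s'. exec (?p N) s t s' \<and> s' N = tfold (\<lambda>x a. h x a ?e) (L ?e) (A ?e) \<and>
        (\<forall>i<N. s' i = s i) \<and> t \<le> ?T ?e"
      by (intro exI conjI, rule exec.Seq[OF e1 exec.Seq[OF 1(1) exec.Seq[OF e2 exec.Seq[OF 2(1)
          exec.Seq[OF 3(1) exec.Assign]]]]])
        (use 1 2 3 s2 in auto)
  qed
qed

text \<open>A fold step receives \<open>Pair x (Pair a e)\<close>; for a function that ignores
  \<open>a\<close>, a bound on \<open>Pair x e\<close> carries over.\<close>

lemma ptime_skip:
  assumes "ptime (\<lambda>p. F (tree_hd p) (tree_tl p))"
  shows "ptime (\<lambda>p. F (tree_hd p) (tree_tl (tree_tl p)))"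
  by (rule ptime_compose2[of F]) (intro assms ptime_hd ptime_tl ptime_id)+

lemma ptest_skip:
  "ptest (\<lambda>p. P (tree_hd p) (tree_tl p)) \<Longrightarrow> ptest (\<lambda>p. P (tree_hd p) (tree_tl (tree_tl p)))"
  unfolding ptest_def by (rule ptime_skip)

lemma ptest_Bex:
  assumes P: "ptest (\<lambda>p. P (tree_hd p) (tree_tl p))" and L: "ptime L"
  shows "ptest (\<lambda>e. \<exists>x\<in>tset (L e). P x e)"
proof -
  have *: "tfold (\<lambda>x a. if Q x then Pair Nil Nil else a) xs (enc_bool b) = enc_bool (b \<or> (\<exists>x\<in>tset xs. Q x))"
    for Q xs b
  proof (induction xs arbitrary: b)
    case (Pair x xs)
    show ?case using Pair.IH(2)[of "b \<or> Q x"] by (cases "Q x") (auto simp: disj_assoc)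
  qed simp
  have "ptime (\<lambda>p. if P (tree_hd p) (tree_tl (tree_tl p)) then Pair Nil Nil else tree_hd (tree_tl p))"
    by (intro ptime_if ptime_Pair ptime_Nil ptime_hd ptime_tl ptime_id ptest_skip ptime_skip P)
  then have "ptime (\<lambda>e. tfold (\<lambda>x a. if P x e then Pair Nil Nil else a) (L e) Nil)"
    by (rule ptime_tfold[OF _ poly_bounded_const[of 3] _ L ptime_Nil]) auto
  with *[where b = False] show ?thesis by (simp add: ptest_def)
qed

lemma ptest_Ball:
  assumes "ptest (\<lambda>p. P (tree_hd p) (tree_tl p))" "ptime L"
  shows "ptest (\<lambda>e. \<forall>x\<in>tset (L e). P x e)"
  using ptest_not[OF ptest_Bex[OF ptest_not[OF assms(1)] assms(2)]] by simp

fun tmap :: "(tree \<Rightarrow> tree) \<Rightarrow> tree \<Rightarrow> tree" where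
  "tmap h Nil = Nil"
| "tmap h (Pair x xs) = Pair (h x) (tmap h xs)"

fun tfilter :: "(tree \<Rightarrow> bool) \<Rightarrow> tree \<Rightarrow> tree" where
  "tfilter P Nil = Nil"
| "tfilter P (Pair x xs) = (if P x then Pair x (tfilter P xs) else tfilter P xs)"

text \<open>Folds deliver their results in reverse; composing with this reversal restores the order
  in \<open>ptime_tmap\<close> and \<open>ptime_tfilter\<close>.\<close>

lemma ptime_trev:
  assumes "ptime L"
  shows "ptime (\<lambda>e. tfold Pair (L e) Nil)"
  by (rule ptime_tfold[where h = "\<lambda>x a e. Pair x a" and q = tsize])
    (intro ptime_Pair ptime_Nil ptime_hd ptime_tl ptime_id poly_bounded_tsize assms | simp)+

lemma ptime_tmap:
  assumes h: "ptime (\<lambda>p. h (tree_hd p) (tree_tl p))" and L: "ptime L"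
  shows "ptime (\<lambda>e. tmap (\<lambda>x. h x e) (L e))"
proof -
  have *: "tfold Pair (tfold (\<lambda>x a. Pair (g x) a) xs a) Nil = tfold Pair a (tmap g xs)" for g xs a
    by (induction xs arbitrary: a) auto
  have "ptime (\<lambda>p. Pair (h (tree_hd p) (tree_tl (tree_tl p))) (tree_hd (tree_tl p)))"
    by (intro ptime_Pair ptime_hd ptime_tl ptime_id ptest_skip ptime_skip assms)
  from ptime_tfold[where h = "\<lambda>x a e. Pair (h x e) a", OF this,
      of "\<lambda>p. 1 + tsize (h (tree_hd p) (tree_tl p))" L "\<lambda>_. Nil"] L ptime_Nil poly_bounded_add[OF poly_bounded_const[of 1] ptime_size[OF h]]
  have "ptime (\<lambda>e. tfold (\<lambda>x a. Pair (h x e) a) (L e) Nil)" by auto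
  from ptime_trev[OF this] show ?thesis by (simp add: *)
qed

lemma ptime_tfilter:
  assumes P: "ptest (\<lambda>p. P (tree_hd p) (tree_tl p))" and L: "ptime L"
  shows "ptime (\<lambda>e. tfilter (\<lambda>x. P x e) (L e))"
proof -
  have *: "tfold Pair (tfold (\<lambda>x a. if Q x then Pair x a else a) xs a) Nil = tfold Pair a (tfilter Q xs)"
    for Q xs a
    by (induction xs arbitrary: a) auto
  have "ptime (\<lambda>p. if P (tree_hd p) (tree_tl (tree_tl p)) then Pair (tree_hd p) (tree_hd (tree_tl p))
      else tree_hd (tree_tl p))"
    by (intro ptime_if ptime_Pair ptime_hd ptime_tl ptime_id ptest_skip ptime_skip P)
  then have "ptime (\<lambda>e. tfold (\<lambda>x a. if P x e then Pair x a else a) (L e) Nil)"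
    by (rule ptime_tfold[OF _ poly_bounded_tsize _ L ptime_Nil]) auto
  from ptime_trev[OF this] show ?thesis by (simp add: *)
qed

text \<open>On unary numbers this is truncated subtraction; it yields the comparisons of lengths,
  since tests can only detect \<open>Nil\<close>.\<close>

definition tdrop :: "tree \<Rightarrow> tree \<Rightarrow> tree" where
  "tdrop xs = tfold (\<lambda>_. tree_tl) xs"

lemma ptime_tdrop:
  assumes "ptime f" "ptime g"
  shows "ptime (\<lambda>x. tdrop (f x) (g x))"
  unfolding tdrop_def
  by (rule ptime_tfold[where h = "\<lambda>x a e. tree_tl a" and q = "\<lambda>_. 0"])
    (intro ptime_hd ptime_tl ptime_id poly_bounded_const assms | simp add: tsize_hd_tl)+

lemma tlen_tdrop: "tlen (tdrop xs ys) = tlen ys - tlen xs"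
proof (induction xs arbitrary: ys)
  case (Pair x xs)
  then show ?case by (cases ys) (auto simp: tdrop_def)
qed (simp add: tdrop_def)

lemma tlen_0_iff: "tlen x = 0 \<longleftrightarrow> x = Nil"
  by (cases x) auto

lemma ptest_tlen_le:
  assumes "ptime f" "ptime g"
  shows "ptest (\<lambda>x. tlen (f x) \<le> tlen (g x))"
  using ptest_Nil[OF ptime_tdrop[OF assms(2,1)]]
  by (simp only: tlen_0_iff[symmetric] tlen_tdrop diff_is_0_eq)

lemma ptest_tlen_eq:
  assumes "ptime f" "ptime g"
  shows "ptest (\<lambda>x. tlen (f x) = tlen (g x))"
  using ptest_conj[OF ptest_tlen_le[OF assms] ptest_tlen_le[OF assms(2,1)]] by (simp add: eq_iff)

lemmas ptime_intros = ptime_id ptime_Nil ptime_hd ptime_tl ptime_Pair ptime_if ptime_enc_bool ptime_tmap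
  ptime_tfilter ptime_tdrop ptest_not ptest_conj ptest_disj ptest_Bex ptest_Ball
  ptest_Nil ptest_tlen_le ptest_tlen_eq

lemma tlen_enc_nat [simp]: "tlen (enc_nat n) = n"
  by (induction n) auto

lemma tlen_enc_bool [simp]: "tlen (enc_bool b) = of_bool b"
  by (cases b) auto

lemma tlen_enc_list [simp]: "tlen (enc_list f xs) = length xs"
  by (induction xs) auto

lemma tset_enc_list [simp]: "tset (enc_list f xs) = f ` set xs"
  by (induction xs) auto

lemma enc_list_Nil_iff [simp]: "enc_list f xs = Nil \<longleftrightarrow> xs = []"
  by (cases xs) auto

lemma tdrop_enc_nat: "tdrop xs (enc_nat n) = enc_nat (n - tlen xs)"
proof (induction xs arbitrary: n)
  case (Pair x xs)
  show ?case using Pair.IH(2)[of "n - 1"] by (cases n) (auto simp: tdrop_def)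
qed (simp add: tdrop_def)

lemma tmap_enc_list:
  "(\<And>x. x \<in> set xs \<Longrightarrow> h (f x) = g (k x)) \<Longrightarrow> tmap h (enc_list f xs) = enc_list g (map k xs)"
  by (induction xs) auto

lemma tfilter_enc_list:
  "(\<And>x. x \<in> set xs \<Longrightarrow> P (f x) \<longleftrightarrow> Q x) \<Longrightarrow> tfilter P (enc_list f xs) = enc_list f (filter Q xs)"
  by (induction xs) auto

section \<open>The branching step on literal lists\<close>

text \<open>
  An assignment of the variables \<open>0, \<dots>, v - 1\<close> is a list of literals \<open>(i, b)\<close>, and a tuple of a
  constraint becomes the list of literals that it forces. A task \<open>(a, \<rho>, v)\<close> stands for the search
  for a satisfying assignment that extends an assignment at distance at most \<open>\<rho>\<close> from \<open>a\<close>.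
\<close>

type_synonym lit = "nat \<times> bool"
type_synonym task = "lit list \<times> nat \<times> nat"

fun neg :: "lit \<Rightarrow> lit" where
  "neg (i, b) = (i, \<not> b)"

text \<open>A variable may occur several times in a constraint; a tuple giving it two values
  corresponds to no assignment and must not produce a move.\<close>

definition consistent :: "lit list \<Rightarrow> bool" where
  "consistent l \<longleftrightarrow> (\<forall>p\<in>set l. neg p \<notin> set l)"

definition force :: "lit list \<Rightarrow> lit list \<Rightarrow> lit list" where
  "force a l = map (\<lambda>p. if neg p \<in> set l then neg p else p) a"

text \<open>The reversal mirrors the order in which \<open>trev_zip\<close> accumulates; what is
  built on it depends only on the set of literals of a tuple.\<close>

definition tuple_lits :: "explicit_constraint \<Rightarrow> lit list list" where
  "tuple_lits C = map (\<lambda>t. rev (zip (fst C) t)) (snd C)"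

definition violated :: "lit list \<Rightarrow> explicit_constraint \<Rightarrow> bool" where
  "violated a C \<longleftrightarrow> (\<forall>l\<in>set (tuple_lits C). \<exists>p\<in>set l. p \<notin> set a)"

text \<open>For assignments of the same variables this is inclusion of flipped sets
  (\<open>between_lits\<close>), expressed by list membership alone so that a program can test
  it.\<close>

definition between :: "lit list \<Rightarrow> lit list \<Rightarrow> lit list \<Rightarrow> bool" where
  "between a y x \<longleftrightarrow> (\<forall>p\<in>set y. p \<in> set a \<or> p \<in> set x)"

text \<open>Keeps an antichain with respect to \<open>between\<close>; a candidate already present
  is dropped because \<open>between\<close> is reflexive.\<close>

definition insert_min :: "lit list \<Rightarrow> lit list \<Rightarrow> lit list list \<Rightarrow> lit list list" where
  "insert_min a x ys =
     (if \<exists>y\<in>set ys. between a y x then ys else x # filter (\<lambda>y. \<not> between a x y) ys)"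

definition min_moves :: "lit list \<Rightarrow> explicit_constraint \<Rightarrow> lit list list" where
  "min_moves a C = fold (insert_min a) (map (force a) (filter consistent (tuple_lits C))) []"

definition flips :: "lit list \<Rightarrow> lit list \<Rightarrow> nat" where
  "flips a x = length (filter (\<lambda>p. p \<notin> set x) a)"

fun block :: "nat \<Rightarrow> bool list \<Rightarrow> lit list \<Rightarrow> lit list" where
  "block v [] a = a"
| "block v (c # w) a = (v, c) # block (Suc v) w a"

text \<open>The last block may overshoot \<open>n\<close>; the surplus variables occur in no
  constraint. Each block raises the budget by 1, the covering radius. The filter on
  \<open>flips a x\<close> keeps the truncated subtraction exact.\<close>

definition branch ::
  "nat \<Rightarrow> bool list list \<Rightarrow> explicit_instance \<Rightarrow> task \<Rightarrow> bool \<times> task list" where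
  "branch b ws = (\<lambda>(n, Cs) (a, \<rho>, v).
     if n \<le> v then
       case filter (violated a) Cs of
         [] \<Rightarrow> (True, [])
       | C # _ \<Rightarrow> (False, map (\<lambda>x. (x, \<rho> - flips a x, v)) (filter (\<lambda>x. flips a x \<le> \<rho>) (min_moves a C)))
     else (False, map (\<lambda>w. (block v w a, Suc \<rho>, v + b)) ws))"

section \<open>Encodings and the branching step on trees\<close>

definition enc_lit :: "lit \<Rightarrow> tree" where
  "enc_lit = (\<lambda>(i, b). Pair (enc_nat i) (enc_bool b))"

abbreviation enc_lits :: "lit list \<Rightarrow> tree" where
  "enc_lits \<equiv> enc_list enc_lit"

text \<open>The budget is encoded by its successor, so that \<open>Nil\<close> signals that it is exceeded.\<close>

definition enc_task :: "task \<Rightarrow> tree" where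
  "enc_task = (\<lambda>(a, \<rho>, v). Pair (enc_lits a) (Pair (enc_nat (Suc \<rho>)) (enc_nat v)))"

text \<open>Equality of trees is not a primitive test; two encoded literals agree when the unary
  lengths of their components do, a Boolean counting as 0 or 1.\<close>

definition tmem :: "tree \<Rightarrow> tree \<Rightarrow> bool" where
  "tmem p l \<longleftrightarrow> (\<exists>q\<in>tset l. tlen (tree_hd p) = tlen (tree_hd q) \<and> tlen (tree_tl p) = tlen (tree_tl q))"

definition tneg :: "tree \<Rightarrow> tree" where
  "tneg p = Pair (tree_hd p) (if tree_tl p = Nil then Pair Nil Nil else Nil)"

definition tconsistent :: "tree \<Rightarrow> bool" where
  "tconsistent l \<longleftrightarrow> (\<forall>p\<in>tset l. \<not> tmem (tneg p) l)"

definition tforce :: "tree \<Rightarrow> tree \<Rightarrow> tree" where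
  "tforce a l = tmap (\<lambda>p. if tmem (tneg p) l then tneg p else p) a"

text \<open>The accumulator pairs the output with the unread rest of the tuple, so that a single
  fold walks along two lists.\<close>

definition trev_zip :: "tree \<Rightarrow> tree \<Rightarrow> tree" where
  "trev_zip vs t = tree_hd (tfold
     (\<lambda>v z. Pair (Pair (Pair v (tree_hd (tree_tl z))) (tree_hd z)) (tree_tl (tree_tl z))) vs (Pair Nil t))"

definition ttuple_lits :: "tree \<Rightarrow> tree" where
  "ttuple_lits C = tmap (\<lambda>t. trev_zip (tree_hd C) t) (tree_tl C)"

definition tviolated :: "tree \<Rightarrow> tree \<Rightarrow> bool" where
  "tviolated a C \<longleftrightarrow> (\<forall>l\<in>tset (ttuple_lits C). \<exists>p\<in>tset l. \<not> tmem p a)"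

definition tbetween :: "tree \<Rightarrow> tree \<Rightarrow> tree \<Rightarrow> bool" where
  "tbetween a y x \<longleftrightarrow> (\<forall>p\<in>tset y. tmem p a \<or> tmem p x)"

definition tinsert_min :: "tree \<Rightarrow> tree \<Rightarrow> tree \<Rightarrow> tree" where
  "tinsert_min a x ys =
     (if \<exists>y\<in>tset ys. tbetween a y x then ys else Pair x (tfilter (\<lambda>y. \<not> tbetween a x y) ys))"

definition tmin_moves :: "tree \<Rightarrow> tree \<Rightarrow> tree" where
  "tmin_moves a C = tfold (\<lambda>x ys. tinsert_min a x ys)
     (tmap (\<lambda>l. tforce a l) (tfilter (\<lambda>l. tconsistent l) (ttuple_lits C))) Nil"

definition tbudget :: "tree \<Rightarrow> tree \<Rightarrow> tree \<Rightarrow> tree" where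
  "tbudget a r x = tdrop (tfilter (\<lambda>p. \<not> tmem p x) a) r"

definition tmoves :: "tree \<Rightarrow> tree \<Rightarrow> tree \<Rightarrow> tree \<Rightarrow> tree" where
  "tmoves a r v C = tmap (\<lambda>x. Pair x (Pair (tbudget a r x) v))
     (tfilter (\<lambda>x. tbudget a r x \<noteq> Nil) (tmin_moves a C))"

text \<open>\<open>w\<close>, \<open>b\<close> and \<open>ws\<close> are constants of the program,
  so the recursions of \<open>tblock\<close>, \<open>tadd\<close> and \<open>tcodes\<close> unroll
  into a fixed number of operations.\<close>

fun tblock :: "tree \<Rightarrow> bool list \<Rightarrow> tree \<Rightarrow> tree" where
  "tblock v [] a = a"
| "tblock v (c # w) a = Pair (Pair v (enc_bool c)) (tblock (Pair Nil v) w a)"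

fun tadd :: "nat \<Rightarrow> tree \<Rightarrow> tree" where
  "tadd 0 v = v"
| "tadd (Suc b) v = Pair Nil (tadd b v)"

fun tcodes :: "nat \<Rightarrow> bool list list \<Rightarrow> tree \<Rightarrow> tree \<Rightarrow> tree \<Rightarrow> tree" where
  "tcodes b [] a r v = Nil"
| "tcodes b (w # ws) a r v = Pair (Pair (tblock v w a) (Pair (Pair Nil r) (tadd b v))) (tcodes b ws a r v)"

definition tbranch :: "nat \<Rightarrow> bool list list \<Rightarrow> tree \<Rightarrow> tree \<Rightarrow> tree \<Rightarrow> tree \<Rightarrow> tree" where
  "tbranch b ws I a r v =
     (if tlen (tree_hd I) \<le> tlen v then
        if tfilter (\<lambda>C. tviolated a C) (tree_tl I) = Nil then Pair (Pair Nil Nil) Nil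
        else Pair Nil (tmoves a r v (tree_hd (tfilter (\<lambda>C. tviolated a C) (tree_tl I))))
      else Pair Nil (tcodes b ws a r v))"

definition branch_tree :: "nat \<Rightarrow> bool list list \<Rightarrow> tree \<Rightarrow> tree" where
  "branch_tree b ws p = tbranch b ws (tree_hd p) (tree_hd (tree_tl p)) (tree_hd (tree_tl (tree_tl p)))
     (tree_tl (tree_tl (tree_tl p)))"

section \<open>Polynomial running time of the branching step\<close>

lemma ptest_tmem: "ptime f \<Longrightarrow> ptime g \<Longrightarrow> ptest (\<lambda>x. tmem (f x) (g x))"
  unfolding ptest_def
  by (rule ptime_compose2[where F = "\<lambda>p l. enc_bool (tmem p l)"]; (unfold tmem_def)?) (intro ptime_intros)

lemma ptime_tneg: "ptime f \<Longrightarrow> ptime (\<lambda>x. tneg (f x))"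
  unfolding tneg_def by (intro ptime_intros)

lemma ptest_tconsistent: "ptime f \<Longrightarrow> ptest (\<lambda>x. tconsistent (f x))"
  unfolding ptest_def
  by (rule ptime_compose[where f = "\<lambda>l. enc_bool (tconsistent l)"]; (unfold tconsistent_def)?)
    (intro ptime_intros ptest_tmem ptime_tneg)

lemma ptime_tforce: "ptime f \<Longrightarrow> ptime g \<Longrightarrow> ptime (\<lambda>x. tforce (f x) (g x))"
  by (rule ptime_compose2[where F = tforce]; (unfold tforce_def)?)
    (intro ptime_intros ptest_tmem ptime_tneg)

lemma ptime_trev_zip: "ptime f \<Longrightarrow> ptime g \<Longrightarrow> ptime (\<lambda>x. trev_zip (f x) (g x))"
  unfolding trev_zip_def
proof (intro ptime_hd ptime_tfold[where h = "\<lambda>v z e. Pair (Pair (Pair v (tree_hd (tree_tl z))) (tree_hd z))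
    (tree_tl (tree_tl z))" and q = "\<lambda>p. 5 + tsize p"] poly_bounded_add poly_bounded_const poly_bounded_tsize ptime_Pair ptime_Nil)
  fix v z e
  show "tsize (Pair (Pair (Pair v (tree_hd (tree_tl z))) (tree_hd z)) (tree_tl (tree_tl z)))
      \<le> tsize z + (5 + tsize (Pair v e))"
    \<comment> \<open>Tuple entries only move from one half of the accumulator to the other; what is
      new is \<open>v\<close> and a constant number of nodes.\<close>
    using tsize_hd_tl(3)[of z] tsize_hd_tl(3)[of "tree_tl z"] by simp
qed (intro ptime_intros; assumption)+

lemma ptime_ttuple_lits: "ptime f \<Longrightarrow> ptime (\<lambda>x. ttuple_lits (f x))"
  by (rule ptime_compose[where f = ttuple_lits]; (unfold ttuple_lits_def)?)
    (intro ptime_intros ptime_trev_zip)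

lemma ptest_tviolated: "ptime f \<Longrightarrow> ptime g \<Longrightarrow> ptest (\<lambda>x. tviolated (f x) (g x))"
  unfolding ptest_def
  by (rule ptime_compose2[where F = "\<lambda>a C. enc_bool (tviolated a C)"]; (unfold tviolated_def)?)
    (intro ptime_intros ptest_tmem ptime_ttuple_lits)

lemma ptest_tbetween:
  "ptime f \<Longrightarrow> ptime g \<Longrightarrow> ptime h \<Longrightarrow> ptest (\<lambda>x. tbetween (f x) (g x) (h x))"
  unfolding ptest_def
  by (rule ptime_compose3[where F = "\<lambda>a y x. enc_bool (tbetween a y x)"]; (unfold tbetween_def)?)
    (intro ptime_intros ptest_tmem)

lemma ptime_tinsert_min:
  "ptime f \<Longrightarrow> ptime g \<Longrightarrow> ptime h \<Longrightarrow> ptime (\<lambda>x. tinsert_min (f x) (g x) (h x))"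
  by (rule ptime_compose3[where F = tinsert_min]; (unfold tinsert_min_def)?)
    (intro ptime_intros ptest_tbetween)

lemma tsize_tfilter: "tsize (tfilter P xs) \<le> tsize xs"
  by (induction xs) auto

lemma ptime_tmin_moves: "ptime f \<Longrightarrow> ptime g \<Longrightarrow> ptime (\<lambda>x. tmin_moves (f x) (g x))"
proof (rule ptime_compose2[where F = tmin_moves], unfold tmin_moves_def,
    rule ptime_tfold[where h = "\<lambda>x ys e. tinsert_min (tree_hd e) x ys" and q = tsize])
  fix x ys e
  show "tsize (tinsert_min (tree_hd e) x ys) \<le> tsize ys + tsize (Pair x e)"
    using tsize_tfilter[of "\<lambda>y. \<not> tbetween (tree_hd e) x y" ys] by (simp add: tinsert_min_def)
qed (intro ptime_intros ptime_tinsert_min ptime_tforce ptest_tconsistent ptime_ttuple_lits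
  poly_bounded_tsize; assumption)+

lemma ptime_tbudget: "ptime f \<Longrightarrow> ptime g \<Longrightarrow> ptime h \<Longrightarrow> ptime (\<lambda>x. tbudget (f x) (g x) (h x))"
  by (rule ptime_compose3[where F = tbudget]; (unfold tbudget_def)?) (intro ptime_intros ptest_tmem)

lemma ptime_tblock: "ptime f \<Longrightarrow> ptime g \<Longrightarrow> ptime (\<lambda>x. tblock (f x) w (g x))"
proof (induction w arbitrary: f g)
  case (Cons c w)
  have "ptime (\<lambda>x. enc_bool c)" by (intro ptime_enc_bool ptest_const)
  then show ?case unfolding tblock.simps by (intro ptime_intros ptest_const Cons)
qed simp

lemma ptime_tadd: "ptime f \<Longrightarrow> ptime (\<lambda>x. tadd b (f x))"
  by (induction b) (simp_all add: ptime_Pair ptime_Nil)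

lemma ptime_tcodes:
  assumes "ptime a" "ptime r" "ptime v"
  shows "ptime (\<lambda>x. tcodes b ws (a x) (r x) (v x))"
proof (induction ws)
  case (Cons w ws)
  then show ?case unfolding tcodes.simps by (intro ptime_intros ptime_tblock ptime_tadd assms)
qed (simp add: ptime_Nil)

lemma ptime_tmoves:
  assumes "ptime a" "ptime r" "ptime v" "ptime C"
  shows "ptime (\<lambda>x. tmoves (a x) (r x) (v x) (C x))"
proof -
  have "ptime (\<lambda>x. tmoves (tree_hd x) (tree_hd (tree_tl x)) (tree_hd (tree_tl (tree_tl x)))
      (tree_tl (tree_tl (tree_tl x))))"
    unfolding tmoves_def by (intro ptime_intros ptime_tbudget ptime_tmin_moves)
  from ptime_compose[OF this, of "\<lambda>x. Pair (a x) (Pair (r x) (Pair (v x) (C x)))"]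
  show ?thesis using assms by (simp add: ptime_Pair)
qed

lemma ptime_branch_tree: "ptime (branch_tree b ws)"
  unfolding branch_tree_def tbranch_def
  by (intro ptime_intros ptime_tmoves ptime_tcodes ptest_tviolated)

section \<open>Agreement of the tree functions with the list functions\<close>

lemma tmem_enc_lits [simp]: "tmem (enc_lit p) (enc_lits l) \<longleftrightarrow> p \<in> set l"
  by (force simp: tmem_def enc_lit_def split: prod.splits)

lemma tneg_enc_lit [simp]: "tneg (enc_lit p) = enc_lit (neg p)"
  by (cases p) (simp add: tneg_def enc_lit_def enc_bool_def)

lemma tconsistent_enc_lits [simp]: "tconsistent (enc_lits l) \<longleftrightarrow> consistent l"
  by (simp add: tconsistent_def consistent_def)

lemma tforce_enc_lits [simp]: "tforce (enc_lits a) (enc_lits l) = enc_lits (force a l)"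
  unfolding tforce_def force_def by (rule tmap_enc_list) simp

lemma trev_zip_enc_list:
  assumes "length t = length vs"
  shows "trev_zip (enc_list enc_nat vs) (enc_list enc_bool t) = enc_lits (rev (zip vs t))"
proof -
  have "tfold (\<lambda>v z. Pair (Pair (Pair v (tree_hd (tree_tl z))) (tree_hd z)) (tree_tl (tree_tl z)))
      (enc_list enc_nat vs) (Pair (enc_lits l) (enc_list enc_bool t)) =
      Pair (enc_lits (rev (zip vs t) @ l)) Nil" for l
    using assms[symmetric]
  proof (induction vs t arbitrary: l rule: list_induct2)
    case (Cons v vs c t)
    from Cons.IH[of "(v, c) # l"] show ?case by (simp add: enc_lit_def)
  qed simp
  from this[of "[]"] show ?thesis by (simp add: trev_zip_def)
qed

text \<open>Automatic for instances over \<open>Inv\<close>, whose relations contain only tuples of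
  the right length; it makes \<open>zip\<close> lossless.\<close>

definition wf_constraint :: "explicit_constraint \<Rightarrow> bool" where
  "wf_constraint C \<longleftrightarrow> (\<forall>t\<in>set (snd C). length t = length (fst C))"

lemma ttuple_lits_enc_constraint [simp]:
  assumes "wf_constraint C"
  shows "ttuple_lits (enc_constraint C) = enc_list enc_lits (tuple_lits C)"
  using assms by (auto simp: ttuple_lits_def tuple_lits_def enc_constraint_def wf_constraint_def
      trev_zip_enc_list split: prod.splits intro!: tmap_enc_list)

lemma tviolated_enc [simp]:
  "wf_constraint C \<Longrightarrow> tviolated (enc_lits a) (enc_constraint C) \<longleftrightarrow> violated a C"
  by (simp add: tviolated_def violated_def)

lemma tbetween_enc_lits [simp]:
  "tbetween (enc_lits a) (enc_lits y) (enc_lits x) \<longleftrightarrow> between a y x"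
  by (simp add: tbetween_def between_def)

lemma tinsert_min_enc_lits:
  "tinsert_min (enc_lits a) (enc_lits x) (enc_list enc_lits ys) = enc_list enc_lits (insert_min a x ys)"
proof -
  have "tfilter (\<lambda>y. \<not> tbetween (enc_lits a) (enc_lits x) y) (enc_list enc_lits ys) =
      enc_list enc_lits (filter (\<lambda>y. \<not> between a x y) ys)"
    by (rule tfilter_enc_list) simp
  then show ?thesis by (simp add: tinsert_min_def insert_min_def)
qed

lemma tmin_moves_enc:
  assumes "wf_constraint C"
  shows "tmin_moves (enc_lits a) (enc_constraint C) = enc_list enc_lits (min_moves a C)"
proof -
  have *: "tfold (tinsert_min (enc_lits a)) (enc_list enc_lits xs) (enc_list enc_lits ys) =
      enc_list enc_lits (fold (insert_min a) xs ys)" for xs ys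
    by (induction xs arbitrary: ys) (simp_all add: tinsert_min_enc_lits)
  have "tfilter tconsistent (enc_list enc_lits (tuple_lits C)) =
      enc_list enc_lits (filter consistent (tuple_lits C))"
    by (rule tfilter_enc_list) simp
  moreover have "tmap (tforce (enc_lits a)) (enc_list enc_lits xs) = enc_list enc_lits (map (force a) xs)"
    for xs by (rule tmap_enc_list) simp
  ultimately show ?thesis
    using assms *[where ys = "[]"] by (simp add: tmin_moves_def min_moves_def)
qed

lemma tbudget_enc:
  "tbudget (enc_lits a) (enc_nat r) (enc_lits x) = enc_nat (r - flips a x)"
proof -
  have "tfilter (\<lambda>p. \<not> tmem p (enc_lits x)) (enc_lits a) = enc_lits (filter (\<lambda>p. p \<notin> set x) a)"
    by (rule tfilter_enc_list) simp
  then show ?thesis by (simp add: tbudget_def tdrop_enc_nat flips_def)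
qed

lemma enc_nat_Nil_iff [simp]: "enc_nat n = Nil \<longleftrightarrow> n = 0"
  by (cases n) auto

lemma tmoves_enc:
  assumes "wf_constraint C"
  shows "tmoves (enc_lits a) (enc_nat (Suc \<rho>)) (enc_nat v) (enc_constraint C) =
    enc_list enc_task (map (\<lambda>x. (x, \<rho> - flips a x, v)) (filter (\<lambda>x. flips a x \<le> \<rho>) (min_moves a C)))"
proof -
  have "tfilter (\<lambda>x. tbudget (enc_lits a) (enc_nat (Suc \<rho>)) x \<noteq> Nil) (enc_list enc_lits (min_moves a C)) =
      enc_list enc_lits (filter (\<lambda>x. flips a x \<le> \<rho>) (min_moves a C))"
    by (rule tfilter_enc_list) (auto simp: tbudget_enc simp del: enc_nat.simps)
  then show ?thesis unfolding tmoves_def tmin_moves_enc[OF assms]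
    by (auto simp: tbudget_enc enc_task_def Suc_diff_le simp del: enc_nat.simps intro!: tmap_enc_list)
qed

lemma tblock_enc: "tblock (enc_nat v) w (enc_lits a) = enc_lits (block v w a)"
proof (induction w arbitrary: v)
  case (Cons c w)
  show ?case using Cons[of "Suc v"] by (simp add: enc_lit_def)
qed simp

lemma tadd_enc: "tadd b (enc_nat v) = enc_nat (v + b)"
  by (induction b) auto

lemma tcodes_enc:
  "tcodes b ws (enc_lits a) (enc_nat (Suc \<rho>)) (enc_nat v) =
    enc_list enc_task (map (\<lambda>w. (block v w a, Suc \<rho>, v + b)) ws)"
  by (induction ws) (auto simp: tblock_enc tadd_enc enc_task_def)

lemma branch_tree_enc:
  assumes "\<forall>C\<in>set (snd I). wf_constraint C"
  shows "branch_tree b ws (Pair (enc_instance I) (enc_task T)) =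
    Pair (enc_bool (fst (branch b ws I T))) (enc_list enc_task (snd (branch b ws I T)))"
proof -
  obtain n Cs where I: "I = (n, Cs)" by (cases I)
  obtain a \<rho> v where T: "T = (a, \<rho>, v)" by (cases T)
  have F: "tfilter (tviolated (enc_lits a)) (enc_list enc_constraint Cs) =
      enc_list enc_constraint (filter (violated a) Cs)"
    by (rule tfilter_enc_list) (use assms I in auto)
  show ?thesis
  proof (cases "n \<le> v \<and> filter (violated a) Cs \<noteq> []")
    case True
    then obtain C Ds where C: "filter (violated a) Cs = C # Ds" by (cases "filter (violated a) Cs") auto
    then have "C \<in> set Cs" by (metis filter_is_subset list.set_intros(1) subsetD)
    then have "wf_constraint C" using assms I by auto
    with True C F tmoves_enc[of C a \<rho> v] show ?thesis
      by (simp add: branch_tree_def tbranch_def branch_def enc_instance_def enc_task_def I T)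
  next
    case False
    then show ?thesis
      using tcodes_enc[of b ws a \<rho> v] F
      by (auto simp: branch_tree_def tbranch_def branch_def enc_instance_def enc_task_def I T)
  qed
qed

section \<open>Minimal moves and sunflowers\<close>

text \<open>By an invariant of the fold, for the set \<open>Z\<close> of candidates seen so far: the
  list is an antichain inside \<open>Z\<close>, and below every member of \<open>Z\<close> lies a
  list element. Transitivity of \<open>between\<close> preserves the latter when a new candidate
  evicts others.\<close>

lemma min_moves_properties:
  fixes a C
  defines "M \<equiv> min_moves a C" and "X \<equiv> force a ` {l \<in> set (tuple_lits C). consistent l}"
  shows "distinct M" "set M \<subseteq> X"
    and "x \<in> set M \<Longrightarrow> y \<in> set M \<Longrightarrow> between a x y \<Longrightarrow> x = y"
    and "z \<in> X \<Longrightarrow> \<exists>y\<in>set M. between a y z"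
proof -
  have refl: "between a x x" for x by (simp add: between_def)
  have trans: "between a x y \<Longrightarrow> between a y z \<Longrightarrow> between a x z" for x y z
    by (auto simp: between_def)
  let ?inv = "\<lambda>Z ys. distinct ys \<and> set ys \<subseteq> Z \<and> (\<forall>x\<in>set ys. \<forall>y\<in>set ys. between a x y \<longrightarrow> x = y) \<and>
    (\<forall>z\<in>Z. \<exists>y\<in>set ys. between a y z)"
  have step: "?inv (insert x Z) (insert_min a x ys)" if inv: "?inv Z ys" for x Z ys
  proof (cases "\<exists>y\<in>set ys. between a y x")
    case True
    then show ?thesis using inv by (auto simp: insert_min_def)
  next
    case False
    have "\<exists>y\<in>set (x # filter (\<lambda>y. \<not> between a x y) ys). between a y z" if z: "z \<in> insert x Z" for z
    proof (cases "z = x")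
      case True
      then show ?thesis using refl by auto
    next
      case False
      then obtain y where "y \<in> set ys" "between a y z" using inv z by auto
      then show ?thesis using trans[of x y z] by (cases "between a x y") auto
    qed
    with False inv refl show ?thesis by (auto simp: insert_min_def)
  qed
  have "?inv (Z \<union> set xs) (fold (insert_min a) xs ys)" if "?inv Z ys" for xs Z ys
    using that
  proof (induction xs arbitrary: Z ys)
    case (Cons x xs)
    from Cons.IH[OF step[OF Cons.prems, of x]] show ?case by simp
  qed simp
  from this[where Z = "{}" and ys = "[]" and xs = "map (force a) (filter consistent (tuple_lits C))"]
  have "?inv X M" by (auto simp: M_def X_def min_moves_def)
  then show "distinct M" "set M \<subseteq> X"
    "x \<in> set M \<Longrightarrow> y \<in> set M \<Longrightarrow> between a x y \<Longrightarrow> x = y"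
    "z \<in> X \<Longrightarrow> \<exists>y\<in>set M. between a y z"
    by blast+
qed

section \<open>Assignments as functions and moves as flipped sets\<close>

definition lits :: "nat list \<Rightarrow> (nat \<Rightarrow> bool) \<Rightarrow> lit list" where
  "lits is f = map (\<lambda>i. (i, f i)) is"

definition flipset :: "lit list \<Rightarrow> lit list \<Rightarrow> nat set" where
  "flipset a x = fst ` (set a - set x)"

lemma mem_lits [simp]: "(i, b) \<in> set (lits is f) \<longleftrightarrow> i \<in> set is \<and> b = f i"
  by (auto simp: lits_def)

lemma flipset_lits: "flipset (lits is f) (lits is g) = {i \<in> set is. f i \<noteq> g i}"
proof -
  have "set (lits is f) - set (lits is g) = (\<lambda>i. (i, f i)) ` {i \<in> set is. f i \<noteq> g i}"
    by (auto simp: lits_def)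
  then show ?thesis by (simp add: flipset_def image_image)
qed

lemma flips_lits:
  assumes "distinct is"
  shows "flips (lits is f) (lits is g) = card {i \<in> set is. f i \<noteq> g i}"
proof -
  have "flips (lits is f) (lits is g) = length (filter (\<lambda>i. f i \<noteq> g i) is)"
    unfolding flips_def by (simp add: lits_def filter_map o_def image_iff cong: filter_cong)
  also have "\<dots> = card (set (filter (\<lambda>i. f i \<noteq> g i) is))"
    using distinct_card[of "filter (\<lambda>i. f i \<noteq> g i) is"] assms by simp
  finally show ?thesis by simp
qed

lemma between_lits:
  "between (lits is f) (lits is g) (lits is h) \<longleftrightarrow>
    flipset (lits is f) (lits is g) \<subseteq> flipset (lits is f) (lits is h)"
  by (auto simp: between_def flipset_lits) (auto simp: lits_def)

lemma force_lits:
  "force (lits is f) l = lits is (\<lambda>i. if (i, \<not> f i) \<in> set l then \<not> f i else f i)"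
  by (simp add: force_def lits_def)

lemma flipset_force:
  "flipset (lits is f) (force (lits is f) l) = {i \<in> set is. (i, \<not> f i) \<in> set l}"
  by (auto simp: force_lits flipset_lits)

lemma nu_eq_Some:
  assumes "3 \<le> k" "length xs = k" "all_but_one xs x"
  shows "nu k xs = Some x"
proof -
  have "y = x" if y: "all_but_one xs y" for y
  proof (rule ccontr)
    assume "y \<noteq> x"
    \<comment> \<open>Every position deviates from \<open>x\<close> or from \<open>y\<close>, so two
      admissible values would give \<open>k \<le> 2\<close>.\<close>
    then have "{i. i < length xs} = {i. i < length xs \<and> xs ! i \<noteq> x} \<union> {i. i < length xs \<and> xs ! i \<noteq> y}"
      by auto
    then have "k \<le> card {i. i < length xs \<and> xs ! i \<noteq> x} + card {i. i < length xs \<and> xs ! i \<noteq> y}"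
      using card_Un_le by (metis assms(2) card_Collect_less_nat)
    then show False using assms y by (simp add: all_but_one_def)
  qed
  then have "(THE x. all_but_one xs x) = x" using assms(3) by (rule the_equality[rotated])
  then show ?thesis using assms by (auto simp: nu_def)
qed

text \<open>A set in \<open>S\<close> names a tuple by the variables at which it departs from
  \<open>f\<close>. On the core all \<open>k\<close> tuples depart; off the core the petals are
  disjoint, so at most one does. Hence \<open>nu k\<close> is defined in every coordinate, and its
  value departs from \<open>f\<close> exactly on the core.\<close>

lemma sunflower_core_mem:
  assumes "3 \<le> k" and inv: "rel_of (vs, ts) \<in> Inv k (nu k)" and S: "sunflower k S"
    and mem: "\<And>A. A \<in> S \<Longrightarrow> \<exists>t\<in>set ts. consistent (zip vs t) \<and> A = {i. (i, \<not> f i) \<in> set (zip vs t)}"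
  shows "map (\<lambda>i. if i \<in> \<Inter>S then \<not> f i else f i) vs \<in> set ts" (is "?u \<in> _")
proof -
  obtain \<tau> where \<tau>: "\<And>A. A \<in> S \<Longrightarrow> \<tau> A \<in> set ts" "\<And>A. A \<in> S \<Longrightarrow> consistent (zip vs (\<tau> A))"
    "\<And>A. A \<in> S \<Longrightarrow> A = {i. (i, \<not> f i) \<in> set (zip vs (\<tau> A))}"
    using mem by metis
  obtain As where As: "set As = S" "distinct As" "length As = k"
    using S finite_distinct_list[of S] distinct_card unfolding sunflower_def by metis
  have len: "length (\<tau> A) = length vs" if "A \<in> S" for A
    using inv \<tau>(1)[OF that] by (auto simp: Inv_def rel_of_def)
  have val: "\<tau> A ! j = (if vs ! j \<in> A then \<not> f (vs ! j) else f (vs ! j))"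
    if A: "A \<in> S" and j: "j < length vs" for A j
  proof -
    have m: "(vs ! j, \<tau> A ! j) \<in> set (zip vs (\<tau> A))"
      using len[OF A] j by (auto simp: set_zip)
    have iff: "vs ! j \<in> A \<longleftrightarrow> (vs ! j, \<not> f (vs ! j)) \<in> set (zip vs (\<tau> A))" using \<tau>(3)[OF A] by blast
    show ?thesis
    proof (cases "vs ! j \<in> A")
      case True
      \<comment> \<open>Membership in \<open>A\<close> may be witnessed by another occurrence of the
        same variable; consistency transfers the flipped value to position \<open>j\<close>.\<close>
      with iff \<tau>(2)[OF A] have "neg (vs ! j, \<not> f (vs ! j)) \<notin> set (zip vs (\<tau> A))"
        unfolding consistent_def by blast
      with m True show ?thesis by (cases "\<tau> A ! j"; cases "f (vs ! j)") auto
    next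
      case False
      with m iff show ?thesis by (cases "\<tau> A ! j"; cases "f (vs ! j)") auto
    qed
  qed
  have "nu k (map (\<lambda>t. t ! j) (map \<tau> As)) = Some (?u ! j)" if j: "j < length vs" for j
  proof (rule nu_eq_Some[OF assms(1)])
    let ?v = "vs ! j" and ?xs = "map (\<lambda>t. t ! j) (map \<tau> As)"
    have AsS: "As ! m \<in> S" if "m < k" for m
      using that As(1,3) by (metis nth_mem)
    have u: "?u ! j = (if ?v \<in> \<Inter>S then \<not> f ?v else f ?v)" using j by simp
    have lxs: "length ?xs = k" using As(3) by simp
    have xs: "?xs ! m = (if ?v \<in> As ! m then \<not> f ?v else f ?v)" if "m < k" for m
      using val[OF AsS[OF that] j] that As(3) by simp
    show "all_but_one ?xs (?u ! j)"
    proof (cases "?v \<in> \<Inter>S")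
      case True
      then have "?xs ! m = (?u ! j)" if "m < k" for m
        unfolding xs[OF that] u using AsS[OF that] by (simp only: if_True InterD)
      then have "{i. i < length ?xs \<and> ?xs ! i \<noteq> ?u ! j} = {}" unfolding lxs by blast
      then show ?thesis unfolding all_but_one_def by (metis card.empty le0)
    next
      case False
      have "m = m'" if "m < k" "m' < k" "?v \<in> As ! m" "?v \<in> As ! m'" for m m'
      proof (rule ccontr)
        assume "m \<noteq> m'"
        then have "As ! m \<noteq> As ! m'" using As(2,3) that by (simp only: nth_eq_iff_index_eq not_False_eq_True)
        moreover have "As ! m \<in> S" "As ! m' \<in> S" using AsS that by blast+
        ultimately have "As ! m \<inter> As ! m' = \<Inter>S" using S unfolding sunflower_def by blast
        with that False show False by blast
      qed
      then have "card {m. m < k \<and> ?v \<in> As ! m} \<le> 1"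
        unfolding One_nat_def by (subst card_le_Suc0_iff_eq) auto
      moreover have "{i. i < length ?xs \<and> ?xs ! i \<noteq> ?u ! j} \<subseteq> {m. m < k \<and> ?v \<in> As ! m}"
        unfolding lxs u using xs False by (auto split: if_splits)
      ultimately show ?thesis
        unfolding all_but_one_def by (elim order_trans[OF card_mono, rotated 2]) simp
    qed
  qed (use As(3) in simp)
  moreover have "preserves k (nu k) (length vs, set ts)"
    using inv by (auto simp: Inv_def rel_of_def)
  moreover have "set (map \<tau> As) \<subseteq> set ts" using \<tau>(1) As by auto
  moreover have "length (map \<tau> As) = k" using As by simp
  moreover have "length ?u = length vs" by simp
  ultimately show ?thesis unfolding preserves_def by blast
qed

lemma card_min_moves_le:
  fixes c :: nat
  assumes k: "3 \<le> k" and inv: "rel_of C \<in> Inv k (nu k)"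
    and sun: "\<And>F :: nat set set. finite F \<Longrightarrow> \<forall>A\<in>F. finite A \<and> card A = d \<Longrightarrow> c ^ d \<le> card F \<Longrightarrow>
      \<exists>S\<subseteq>F. sunflower k S"
    and "distinct is" and vs: "set (fst C) \<subseteq> set is"
  shows "card {x \<in> set (min_moves (lits is f) C). flips (lits is f) x = d} \<le> c ^ d"
proof (rule ccontr)
  obtain vs ts where C: "C = (vs, ts)" by (cases C)
  let ?a = "lits is f"
  let ?M = "min_moves ?a C"
  let ?G = "{x \<in> set ?M. flips ?a x = d}"
  let ?W = "\<lambda>t. {i. (i, \<not> f i) \<in> set (zip vs t)}"
  note M = min_moves_properties[where a = ?a and C = C]
  have W: "flipset ?a (force ?a (rev (zip vs t))) = ?W t" for t
    using vs C by (auto simp: flipset_force dest: set_zip_leftD)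
  have Md: "\<exists>t\<in>set ts. consistent (zip vs t) \<and> x = force ?a (rev (zip vs t)) \<and> flipset ?a x = ?W t"
    if x: "x \<in> set ?M" for x
    using M(2) x W by (force simp: tuple_lits_def C consistent_def)
  have btw: "between ?a x y \<longleftrightarrow> flipset ?a x \<subseteq> flipset ?a y"
    if "x \<in> range (force ?a)" "y \<in> range (force ?a)" for x y
  proof -
    from that obtain l m where "x = force ?a l" "y = force ?a m" by blast
    then show ?thesis by (simp only: force_lits between_lits)
  qed
  have MF: "x \<in> range (force ?a)" if "x \<in> set ?M" for x using M(2) that by auto
  have "inj_on (flipset ?a) (set ?M)"
    by (rule inj_onI) (metis M(3) MF btw order_refl)
  then have inj: "inj_on (flipset ?a) ?G" by (rule inj_on_subset) auto
  assume "\<not> card ?G \<le> c ^ d"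
  then have "c ^ d \<le> card (flipset ?a ` ?G)" by (simp add: card_image[OF inj])
  moreover have "\<forall>A\<in>flipset ?a ` ?G. finite A \<and> card A = d"
  proof
    fix A assume "A \<in> flipset ?a ` ?G"
    then obtain x where x: "x \<in> set ?M" "flips ?a x = d" "A = flipset ?a x" by auto
    moreover obtain g where "x = lits is g" using MF[OF x(1)] force_lits by auto
    ultimately show "finite A \<and> card A = d"
      using flips_lits[OF \<open>distinct is\<close>, of f g] flipset_lits[of "is" f g] by simp
  qed
  ultimately obtain S where S: "S \<subseteq> flipset ?a ` ?G" "sunflower k S"
    using sun[of "flipset ?a ` ?G"] by auto
  let ?u = "map (\<lambda>i. if i \<in> \<Inter>S then \<not> f i else f i) vs"
  have u: "?u \<in> set ts"
  proof (rule sunflower_core_mem[OF k _ S(2)])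
    show "rel_of (vs, ts) \<in> Inv k (nu k)" using inv C by simp
    fix A assume "A \<in> S"
    then obtain x where "x \<in> set ?M" "A = flipset ?a x" using S(1) by auto
    with Md[of x] show "\<exists>t\<in>set ts. consistent (zip vs t) \<and> A = ?W t" by blast
  qed
  have zu: "set (zip vs ?u) = (\<lambda>i. (i, if i \<in> \<Inter>S then \<not> f i else f i)) ` set vs"
    by (simp add: zip_map2 zip_same_conv_map image_image)
  have "consistent (rev (zip vs ?u))"
    unfolding consistent_def set_rev zu by (auto split: if_splits)
  with u have "force ?a (rev (zip vs ?u)) \<in> force ?a ` {l \<in> set (tuple_lits C). consistent l}"
    by (auto simp: tuple_lits_def C)
  from M(4)[OF this] obtain y where y: "y \<in> set ?M" "between ?a y (force ?a (rev (zip vs ?u)))"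
    by blast
  then have "flipset ?a y \<subseteq> ?W ?u" using btw[OF MF[OF y(1)]] W by blast
  also have "\<dots> \<subseteq> \<Inter>S" unfolding zu by (auto split: if_splits)
  finally have sub: "flipset ?a y \<subseteq> A" if "A \<in> S" for A using that by auto
  \<comment> \<open>Flipping the core yields a candidate, so the minimal move \<open>y\<close> below
    it flips only core variables. It lies below every member of the sunflower, and the antichain
    property identifies them all with it, leaving one set where \<open>k\<close> are
    required.\<close>
  have "A = flipset ?a y" if A: "A \<in> S" for A
  proof -
    obtain x where x: "x \<in> set ?M" "A = flipset ?a x" using A S(1) by auto
    then have "between ?a y x" using sub[OF A] btw[OF MF[OF y(1)] MF[OF x(1)]] by simp
    then show ?thesis using M(3)[OF y(1) x(1)] x by simp
  qed
  then have "S \<subseteq> {flipset ?a y}" by blast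
  then have "card S \<le> 1" using card_mono[of "{flipset ?a y}" S] by simp
  with S(2) k show False by (simp add: sunflower_def)
qed

section \<open>Correctness and size of the search tree\<close>

lemma block_eq: "block v w a = zip [v..<v + length w] w @ a"
proof (induction w arbitrary: v)
  case (Cons c w)
  then show ?case using upt_conv_Cons[of v "v + length (c # w)"] by simp
qed simp

lemma block_lits:
  assumes "set is = {..<v}"
  shows "block v w (lits is f) =
    lits ([v..<v + length w] @ is) (\<lambda>i. if v \<le> i then w ! (i - v) else f i)"
proof -
  have "zip [v..<v + length w] w = map (\<lambda>i. (i, w ! (i - v))) [v..<v + length w]"
    by (rule nth_equalityI) auto
  moreover have "map (\<lambda>i. (i, f i)) is = map (\<lambda>i. (i, if v \<le> i then w ! (i - v) else f i)) is"
    using assms by auto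
  ultimately show ?thesis by (simp add: block_eq lits_def)
qed

text \<open>The constant \<open>c\<close> is that of the sunflower conjecture, made integral and positive.\<close>

locale search =
  fixes k c b :: nat and ws :: "bool list list" and I :: explicit_instance
  assumes k: "3 \<le> k" and c: "1 \<le> c" and b: "1 \<le> b"
    and sunflowers: "\<And>d (F :: nat set set). 1 \<le> d \<Longrightarrow> finite F \<Longrightarrow> \<forall>A\<in>F. finite A \<and> card A = d \<Longrightarrow>
      c ^ d \<le> card F \<Longrightarrow> \<exists>S\<subseteq>F. sunflower k S"
    and code_length: "\<And>w. w \<in> set ws \<Longrightarrow> length w = b"
    and covering: "\<And>u. length u = b \<Longrightarrow> \<exists>w\<in>set ws. card {j. j < b \<and> w ! j \<noteq> u ! j} \<le> 1"
    and inst: "I \<in> SAT_instances (Inv k (nu k))"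
begin

text \<open>Only the last block overshoots, by fewer than \<open>b\<close> variables;
  \<open>\<rho> \<le> v\<close> bounds the size of the encoded budget.\<close>

definition valid :: "task \<Rightarrow> bool" where
  "valid = (\<lambda>(a, \<rho>, v). (\<exists>is f. a = lits is f \<and> distinct is \<and> set is = {..<v}) \<and> v < fst I + b \<and> \<rho> \<le> v)"

definition solves :: "(nat \<Rightarrow> bool) \<Rightarrow> bool" where
  "solves g \<longleftrightarrow> (\<forall>(vs, ts)\<in>set (snd I). map g vs \<in> set ts)"

text \<open>Distance is measured on the variables already fixed, so the empty initial task is
  promising iff the instance is satisfiable.\<close>

definition promising :: "task \<Rightarrow> bool" where
  "promising = (\<lambda>(a, \<rho>, v). \<exists>g. solves g \<and> flips a (lits (map fst a) g) \<le> \<rho>)"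

text \<open>Bounds the size of the search tree below a task. The second exponent is the number of
  blocks still to be filled, rounded up: filling one contributes \<open>length ws\<close> choices
  and a factor \<open>2 * c\<close> for the extra unit of budget, and the added 1 pays for the node
  itself.\<close>

definition weight :: "task \<Rightarrow> nat" where
  "weight = (\<lambda>(a, \<rho>, v). (2 * c) ^ \<rho> * (length ws * (2 * c) + 1) ^ ((fst I - v + b - 1) div b))"

lemma satisfiable_iff: "satisfiable I \<longleftrightarrow> (\<exists>g. solves g)"
  by (simp add: satisfiable_def solves_def case_prod_unfold)

lemma inst_constraint:
  assumes "C \<in> set (snd I)"
  shows "rel_of C \<in> Inv k (nu k)" "set (fst C) \<subseteq> {..<fst I}" "wf_constraint C"
proof -
  have "rel_of C \<in> Inv k (nu k) \<and> set (fst C) \<subseteq> {..<fst I}"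
    using assms inst unfolding SAT_instances_def by (cases I) fastforce
  then show "rel_of C \<in> Inv k (nu k)" "set (fst C) \<subseteq> {..<fst I}" "wf_constraint C"
    by (auto simp: wf_constraint_def Inv_def rel_of_def split: prod.splits)
qed

lemma validE:
  assumes "valid (a, \<rho>, v)"
  obtains "is" f where "a = lits is f" "distinct is" "set is = {..<v}" "v < fst I + b" "\<rho> \<le> v"
  using assms unfolding valid_def by auto

lemma valid_lits:
  "distinct is \<Longrightarrow> set is = {..<v} \<Longrightarrow> v < fst I + b \<Longrightarrow> \<rho> \<le> v \<Longrightarrow> valid (lits is f, \<rho>, v)"
  unfolding valid_def by auto

lemma promising_lits:
  assumes "distinct is"
  shows "promising (lits is f, \<rho>, v) \<longleftrightarrow> (\<exists>g. solves g \<and> card {i \<in> set is. f i \<noteq> g i} \<le> \<rho>)"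
proof -
  have "map fst (lits is f) = is" by (simp add: lits_def o_def)
  then show ?thesis by (simp add: promising_def flips_lits[OF assms])
qed

lemma branch_cases:
  assumes "valid (a, \<rho>, v)"
  obtains (accept) "fst I \<le> v" "filter (violated a) (snd I) = []"
      "branch b ws I (a, \<rho>, v) = (True, [])"
    | (move) C where "fst I \<le> v" "C \<in> set (snd I)" "violated a C" "branch b ws I (a, \<rho>, v) =
        (False, map (\<lambda>x. (x, \<rho> - flips a x, v)) (filter (\<lambda>x. flips a x \<le> \<rho>) (min_moves a C)))"
    | (extend) "v < fst I"
      "branch b ws I (a, \<rho>, v) = (False, map (\<lambda>w. (block v w a, Suc \<rho>, v + b)) ws)"
proof (cases "fst I \<le> v")
  case True
  show ?thesis
  proof (cases "filter (violated a) (snd I)")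
    case Nil
    then show ?thesis using True accept by (cases I) (simp add: branch_def)
  next
    case (Cons C Ds)
    then have "C \<in> set (filter (violated a) (snd I))" by simp
    then have "C \<in> set (snd I)" "violated a C" by auto
    then show ?thesis using True Cons move by (cases I) (simp add: branch_def)
  qed
next
  case False
  then show ?thesis using extend by (cases I) (simp add: branch_def)
qed

lemma min_moves_lits:
  assumes "C \<in> set (snd I)" "fst I \<le> v" "set is = {..<v}" "x \<in> set (min_moves (lits is f) C)"
  obtains l where "l \<in> set (tuple_lits C)" "consistent l" "x = force (lits is f) l"
    "flipset (lits is f) x = {i. (i, \<not> f i) \<in> set l}"
proof -
  from min_moves_properties(2)[of "lits is f" C] assms(4)
  obtain l where l: "l \<in> set (tuple_lits C)" "consistent l" "x = force (lits is f) l" by auto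
  have "i < v" if "(i, b') \<in> set l" for i b'
    using l(1) that assms(2) inst_constraint(2)[OF assms(1)]
    by (auto simp: tuple_lits_def dest!: set_zip_leftD)
  then have "flipset (lits is f) x = {i. (i, \<not> f i) \<in> set l}"
    unfolding l(3) flipset_force assms(3) by auto
  with l that show ?thesis by blast
qed

lemma accept_imp_satisfiable:
  assumes "valid T" "fst (branch b ws I T)"
  shows "satisfiable I"
proof -
  obtain a \<rho> v where T: "T = (a, \<rho>, v)" by (cases T)
  from assms(1)[unfolded T] obtain "is" f where a: "a = lits is f" by (rule validE)
  have "filter (violated a) (snd I) = []"
    using branch_cases[OF assms(1)[unfolded T]] assms(2) unfolding T by fastforce
  then have nv: "\<not> violated a C" if "C \<in> set (snd I)" for C using that by (simp add: filter_empty_conv)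
  have "map f vs \<in> set ts" if C: "(vs, ts) \<in> set (snd I)" for vs ts
  proof -
    obtain t where t: "t \<in> set ts" "set (zip vs t) \<subseteq> set a"
      using nv[OF C] by (auto simp: violated_def tuple_lits_def)
    have "length t = length vs" using inst_constraint(3)[OF C] t(1) by (simp add: wf_constraint_def)
    moreover have "t ! j = f (vs ! j)" if "j < length vs" for j
    proof -
      have "(vs ! j, t ! j) \<in> set (zip vs t)" using that \<open>length t = length vs\<close> by (auto simp: set_zip)
      with t(2) show ?thesis unfolding a by auto
    qed
    ultimately have "map f vs = t" by (intro nth_equalityI) auto
    with t(1) show ?thesis by simp
  qed
  then show ?thesis unfolding satisfiable_iff solves_def by auto
qed

text \<open>Let \<open>g\<close> be a solution within budget. In a violated constraint the tuple of
  \<open>g\<close> gives a candidate, and a minimal move below it flips only variables where the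
  assignment differs from \<open>g\<close>, so distance and budget fall by the same amount. On a new
  block some code word is within distance 1 of \<open>g\<close>.\<close>

lemma branch_promising:
  assumes "valid T" "promising T" "\<not> fst (branch b ws I T)"
  shows "\<exists>T'\<in>set (snd (branch b ws I T)). promising T'"
proof -
  obtain a \<rho> v where T: "T = (a, \<rho>, v)" by (cases T)
  from assms(1)[unfolded T] obtain "is" f where a: "a = lits is f" and ds: "distinct is" "set is = {..<v}"
    by (rule validE)
  obtain g where g: "solves g" "card {i \<in> set is. f i \<noteq> g i} \<le> \<rho>"
    using assms(2) promising_lits[OF ds(1)] unfolding T a by auto
  from assms(1)[unfolded T] show ?thesis
  proof (cases rule: branch_cases)
    case accept
    then show ?thesis using assms(3) T by simp
  next
    case (move C)
    obtain vs ts where C: "C = (vs, ts)" by (cases C)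
    let ?l = "rev (zip vs (map g vs))"
    have l: "set ?l = (\<lambda>i. (i, g i)) ` set vs"
      by (simp add: zip_map2 zip_same_conv_map image_image)
    have "map g vs \<in> set ts" using g(1) move(2) C by (auto simp: solves_def)
    moreover have "consistent ?l" unfolding consistent_def l by auto
    ultimately have "force a ?l \<in> force a ` {l \<in> set (tuple_lits C). consistent l}"
      by (auto simp: tuple_lits_def C)
    from min_moves_properties(4)[OF this] obtain y where
      y: "y \<in> set (min_moves a C)" "between a y (force a ?l)" by blast
    obtain h where h: "y = lits is h"
      using min_moves_properties(2)[of a C] y(1) unfolding a force_lits by blast
    have sub: "{i \<in> set is. f i \<noteq> h i} \<subseteq> {i \<in> set is. f i \<noteq> g i}"
      using y(2) unfolding h a force_lits between_lits flipset_lits l by (auto split: if_splits)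
    have eq: "{i \<in> set is. h i \<noteq> g i} = {i \<in> set is. f i \<noteq> g i} - {i \<in> set is. f i \<noteq> h i}"
      using sub by auto
    have "flips a y \<le> card {i \<in> set is. f i \<noteq> g i}"
      unfolding a h flips_lits[OF ds(1)] by (rule card_mono[OF _ sub]) auto
    moreover have "card {i \<in> set is. h i \<noteq> g i} = card {i \<in> set is. f i \<noteq> g i} - flips a y"
      unfolding eq unfolding a h flips_lits[OF ds(1)] by (rule card_Diff_subset[OF _ sub]) auto
    ultimately have "flips a y \<le> \<rho>" "card {i \<in> set is. h i \<noteq> g i} \<le> \<rho> - flips a y"
      using g(2) by auto
    then have "promising (y, \<rho> - flips a y, v)" "(y, \<rho> - flips a y, v) \<in> set (snd (branch b ws I T))"
      using g(1) promising_lits[OF ds(1), of h] y(1) move(4) T unfolding h by auto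
    then show ?thesis by blast
  next
    case extend
    obtain w where w: "w \<in> set ws" "card {j. j < b \<and> w ! j \<noteq> map g [v..<v + b] ! j} \<le> 1"
      using covering[of "map g [v..<v + b]"] by auto
    let ?f = "\<lambda>i. if v \<le> i then w ! (i - v) else f i" and ?is = "[v..<v + b] @ is"
    have bl: "block v w a = lits ?is ?f"
      using block_lits[OF ds(2), of w f] code_length[OF w(1)] a by simp
    have d: "distinct ?is" using ds by (simp add: disjoint_iff)
    have "{i \<in> set ?is. ?f i \<noteq> g i} \<subseteq>
        (\<lambda>j. v + j) ` {j. j < b \<and> w ! j \<noteq> map g [v..<v + b] ! j} \<union> {i \<in> set is. f i \<noteq> g i}"
    proof
      fix i assume i: "i \<in> {i \<in> set ?is. ?f i \<noteq> g i}"
      show "i \<in> (\<lambda>j. v + j) ` {j. j < b \<and> w ! j \<noteq> map g [v..<v + b] ! j} \<union> {i \<in> set is. f i \<noteq> g i}"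
      proof (cases "v \<le> i")
        case True
        then obtain j where j: "i = v + j" using le_Suc_ex by blast
        then have "j < b" using i ds(2) by simp
        moreover have "w ! j \<noteq> map g [v..<v + b] ! j" using i j \<open>j < b\<close> by simp
        ultimately show ?thesis using j by blast
      next
        case False
        then show ?thesis using i by simp
      qed
    qed
    from card_mono[OF _ this] have "card {i \<in> set ?is. ?f i \<noteq> g i} \<le>
        card ((\<lambda>j. v + j) ` {j. j < b \<and> w ! j \<noteq> map g [v..<v + b] ! j} \<union> {i \<in> set is. f i \<noteq> g i})"
      by auto
    also have "\<dots> \<le> card ((\<lambda>j. v + j) ` {j. j < b \<and> w ! j \<noteq> map g [v..<v + b] ! j}) +
        card {i \<in> set is. f i \<noteq> g i}"
      by (rule card_Un_le)
    also have "\<dots> \<le> 1 + \<rho>"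
      using w(2) g(2) by (intro add_mono order_trans[OF card_image_le]) auto
    finally have "promising (block v w a, Suc \<rho>, v + b)"
      unfolding bl promising_lits[OF d] plus_1_eq_Suc using g(1) by blast
    then show ?thesis using w(1) extend(2) T by auto
  qed
qed

lemma branch_valid:
  assumes "valid T" "T' \<in> set (snd (branch b ws I T))"
  shows "valid T'"
proof -
  obtain a \<rho> v where T: "T = (a, \<rho>, v)" by (cases T)
  from assms(1)[unfolded T] obtain "is" f where a: "a = lits is f" and ds: "distinct is" "set is = {..<v}"
    and v: "v < fst I + b" "\<rho> \<le> v"
    by (rule validE)
  from assms(1)[unfolded T] show ?thesis
  proof (cases rule: branch_cases)
    case accept
    then show ?thesis using assms(2) T by simp
  next
    case (move C)
    then obtain x where x: "x \<in> set (min_moves a C)" "T' = (x, \<rho> - flips a x, v)"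
      using assms(2) T by auto
    moreover obtain h where h: "x = lits is h"
      using min_moves_properties(2)[of a C] x(1) unfolding a force_lits by blast
    ultimately show ?thesis using valid_lits[OF ds v(1)] v(2) by simp
  next
    case extend
    from assms(2) have "T' \<in> set (map (\<lambda>w. (block v w a, Suc \<rho>, v + b)) ws)"
      unfolding T extend(2) by (simp only: snd_conv)
    then obtain w where w: "w \<in> set ws" "T' = (block v w a, Suc \<rho>, v + b)"
      unfolding set_map by blast
    have "set ([v..<v + b] @ is) = {..<v + b}"
      unfolding set_append set_upt ds(2) by (intro set_eqI) (simp, linarith)
    moreover have "distinct ([v..<v + b] @ is)" using ds by (simp add: disjoint_iff)
    ultimately show ?thesis
      unfolding w(2) a block_lits[OF ds(2)] code_length[OF w(1)]
      by (intro valid_lits) (use extend(1) v(2) b in simp_all)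
  qed
qed

lemma branch_weight:
  assumes "valid T"
  shows "1 + (\<Sum>T'\<leftarrow>snd (branch b ws I T). weight T') \<le> weight T"
proof -
  obtain a \<rho> v where T: "T = (a, \<rho>, v)" by (cases T)
  let ?K = "2 * c"
  from assms[unfolded T] obtain "is" f where a: "a = lits is f" and ds: "distinct is" "set is = {..<v}"
    and v: "v < fst I + b" "\<rho> \<le> v"
    by (rule validE)
  from assms[unfolded T] show ?thesis
  proof (cases rule: branch_cases)
    case accept
    then show ?thesis using T c by (simp add: weight_def)
  next
    case (move C)
    let ?M = "min_moves a C"
    let ?X = "{x \<in> set ?M. flips a x \<le> \<rho>}"
    \<comment> \<open>All blocks are filled, so only the budget contributes to the weight.\<close>
    have e: "(fst I - v + b - 1) div b = 0" using move(1) b by simp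
    \<comment> \<open>A move that flips nothing would mean that the violated constraint already
      holds. So sizes start at 1, as the sunflower hypothesis demands.\<close>
    have pos: "flips a x \<noteq> 0" if x: "x \<in> set ?M" for x
    proof
      assume 0: "flips a x = 0"
      obtain l where l: "l \<in> set (tuple_lits C)" "x = force (lits is f) l"
        "flipset (lits is f) x = {i. (i, \<not> f i) \<in> set l}"
        using min_moves_lits[OF move(2,1) ds(2)] x unfolding a by metis
      have "flipset (lits is f) x = {}"
        using 0 unfolding a l(2) force_lits flips_lits[OF ds(1)] flipset_lits by simp
      then have nf: "(i, \<not> f i) \<notin> set l" for i using l(3) by auto
      have "p \<in> set a" if p: "p \<in> set l" for p
      proof -
        obtain i b' where ib: "p = (i, b')" by (cases p)
        have "i < v" using l(1) p ib move(1) inst_constraint(2)[OF move(2)]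
          by (auto simp: tuple_lits_def dest!: set_zip_leftD)
        moreover have "b' = f i" using nf[of i] p ib by (cases b'; cases "f i") auto
        ultimately show ?thesis using ib ds(2) a by simp
      qed
      then show False using move(3) l(1) unfolding violated_def by blast
    qed
    have card: "card {x \<in> ?X. flips a x = d} \<le> c ^ d" if "d \<in> {1..\<rho>}" for d
    proof -
      have "card {x \<in> set ?M. flips a x = d} \<le> c ^ d"
        unfolding a
      proof (rule card_min_moves_le[OF k inst_constraint(1)[OF move(2)] _ ds(1)])
        show "set (fst C) \<subseteq> set is" using inst_constraint(2)[OF move(2)] move(1) ds(2) by auto
      qed (use sunflowers that in auto)
      moreover have "card {x \<in> ?X. flips a x = d} \<le> card {x \<in> set ?M. flips a x = d}"
        by (rule card_mono) auto
      ultimately show ?thesis by simp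
    qed
    have "(\<Sum>T'\<leftarrow>snd (branch b ws I T). weight T') =
        (\<Sum>x\<leftarrow>filter (\<lambda>x. flips a x \<le> \<rho>) ?M. ?K ^ (\<rho> - flips a x))"
      using move(4) e unfolding T by (simp add: weight_def o_def)
    also have "\<dots> = (\<Sum>x\<in>?X. ?K ^ (\<rho> - flips a x))"
      using min_moves_properties(1)[of a C] by (subst sum_list_distinct_conv_sum_set) auto
    also have "\<dots> = (\<Sum>d\<in>{1..\<rho>}. \<Sum>x\<in>{x \<in> ?X. flips a x = d}. ?K ^ (\<rho> - flips a x))"
      using pos by (intro sum.group[symmetric]) (auto simp: Suc_le_eq)
    also have "\<dots> = (\<Sum>d\<in>{1..\<rho>}. card {x \<in> ?X. flips a x = d} * ?K ^ (\<rho> - d))"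
      by (rule sum.cong) auto
    also have "\<dots> \<le> (\<Sum>d\<in>{1..\<rho>}. c ^ d * ?K ^ (\<rho> - d))"
      by (intro sum_mono mult_right_mono card) auto
    also have "\<dots> = (\<Sum>d\<in>{1..\<rho>}. c ^ \<rho> * 2 ^ (\<rho> - d))"
      by (rule sum.cong) (auto simp: power_mult_distrib simp flip: power_add)
    also have "\<dots> = c ^ \<rho> * (\<Sum>d\<in>{1..\<rho>}. 2 ^ (\<rho> - d))"
      by (simp add: sum_distrib_left)
    also have "(\<Sum>d\<in>{1..\<rho>}. 2 ^ (\<rho> - d)) = (\<Sum>j<\<rho>. 2 ^ j :: nat)"
      by (rule sum.reindex_bij_witness[of _ "\<lambda>j. \<rho> - j" "\<lambda>d. \<rho> - d"]) auto
    also have "\<dots> = 2 ^ \<rho> - 1" by (simp add: lessThan_atLeast0 sum_power2)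
    finally have "1 + (\<Sum>T'\<leftarrow>snd (branch b ws I T). weight T') \<le> 1 + c ^ \<rho> * (2 ^ \<rho> - 1)" by simp
    also have "\<dots> \<le> c ^ \<rho> + c ^ \<rho> * (2 ^ \<rho> - 1)" using c by simp
    also have "\<dots> = ?K ^ \<rho>" by (simp add: power_mult_distrib algebra_simps)
    also have "\<dots> = weight T" using e by (simp add: weight_def T)
    finally show ?thesis .
  next
    case extend
    let ?B = "length ws * ?K + 1"
    define j where "j = (fst I - (v + b) + b - 1) div b"
    \<comment> \<open>Filling a block lowers the rounded-up count by exactly 1, also when the block
      reaches or overshoots the last variable (the case \<open>Suc m \<le> b\<close>).\<close>
    have j: "(fst I - v + b - 1) div b = Suc j"
    proof -
      obtain m where m: "fst I = v + Suc m" using extend(1) less_imp_Suc_add by auto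
      show ?thesis
      proof (cases "Suc m \<le> b")
        case True
        then have "Suc m + b - 1 = b + m" "m < b" by auto
        then show ?thesis using m b True by (simp add: j_def div_add_self1)
      next
        case False
        then obtain r where "Suc m = r + b" using le_Suc_ex[of b "Suc m"] by (metis add.commute nat_le_linear)
        then have "fst I - v + b - 1 = (r + b - 1) + b" "fst I - (v + b) + b - 1 = r + b - 1"
          using m b by auto
        then show ?thesis using div_add_self2[of b "r + b - 1"] b by (simp only: j_def Suc_eq_plus1)
      qed
    qed
    have "(\<Sum>T'\<leftarrow>snd (branch b ws I T). weight T') = length ws * (?K ^ Suc \<rho> * ?B ^ j)"
      using extend(2) unfolding T by (simp add: weight_def o_def sum_list_triv j_def)
    then have "1 + (\<Sum>T'\<leftarrow>snd (branch b ws I T). weight T') = 1 + (?K ^ \<rho> * ?B ^ j) * (length ws * ?K)"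
      by (simp add: algebra_simps)
    also have "\<dots> \<le> ?K ^ \<rho> * ?B ^ j + (?K ^ \<rho> * ?B ^ j) * (length ws * ?K)"
      using c by simp
    also have "\<dots> = weight T" unfolding T weight_def prod.case j by (simp add: algebra_simps)
    finally show ?thesis .
  qed
qed

end

section \<open>Covering codes of radius one\<close>

text \<open>
  Flipping one well-chosen position changes the syndrome of a word to any prescribed value, so each
  syndrome class is a covering code of radius 1, and the smallest of the \<open>2 ^ m\<close> classes contains at
  most a \<open>2 ^ m\<close>-th of all words.
\<close>

fun syndrome :: "nat \<Rightarrow> bool list \<Rightarrow> nat" where
  "syndrome i [] = 0"
| "syndrome i (c # w) = xor (if c then i else 0) (syndrome (Suc i) w)"

lemma syndrome_flip:
  "j < length w \<Longrightarrow> syndrome i (w[j := \<not> w ! j]) = xor (i + j) (syndrome i w)"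
proof (induction w arbitrary: i j)
  case (Cons c w)
  show ?case
  proof (cases j)
    case 0
    have "xor i (xor i s) = s" for s :: nat by (simp flip: xor.assoc)
    then show ?thesis using 0 by simp
  next
    case (Suc j')
    then show ?thesis using Cons.IH[of j' "Suc i"] Cons.prems by (simp add: xor.left_commute)
  qed
qed simp

lemma xor_less_exp: "xor a b < 2 ^ m" if "a < 2 ^ m" "b < 2 ^ m" for a b :: nat
  using that by (metis take_bit_nat_eq_self_iff take_bit_xor)

lemma syndrome_less: "i + length w \<le> 2 ^ m \<Longrightarrow> syndrome i w < 2 ^ m"
  by (induction w arbitrary: i) (auto intro!: xor_less_exp)

lemma ex_covering_code:
  obtains b and ws :: "bool list list" where "1 \<le> b" "\<And>w. w \<in> set ws \<Longrightarrow> length w = b"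
    "\<And>u. length u = b \<Longrightarrow> \<exists>w\<in>set ws. card {j. j < b \<and> w ! j \<noteq> u ! j} \<le> 1"
    "length ws * K + 1 < 2 ^ b"
proof -
  \<comment> \<open>Chosen to get \<open>2 * K < 2 ^ m\<close>: the \<open>M\<close> words of a
    smallest class then satisfy \<open>M * (2 * K + 1) \<le> 2 ^ b\<close>, which leaves room for
    the summand 1 and for strictness.\<close>
  define m where "m = 2 * K"
  have m: "2 * K < 2 ^ m" unfolding m_def by (rule less_exp)
  let ?b = "2 ^ m :: nat"
  let ?L = "\<lambda>s. {w :: bool list. length w = ?b \<and> syndrome 0 w = s}"
  have fin: "finite {w :: bool list. length w = ?b}" and card: "card {w :: bool list. length w = ?b} = 2 ^ ?b"
    using finite_lists_length_eq[of "UNIV :: bool set" ?b] card_lists_length_eq[of "UNIV :: bool set" ?b]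
    by simp_all
  have finL: "finite (?L s)" for s by (rule finite_subset[OF _ fin]) auto
  have "\<exists>s<?b. card (?L s) * ?b \<le> 2 ^ ?b"
  proof (rule ccontr)
    assume "\<not> ?thesis"
    then have less: "2 ^ ?b < card (?L s) * ?b" if "s < ?b" for s using that by (meson not_le)
    have "{w :: bool list. length w = ?b} = (\<Union>s\<in>{..<?b}. ?L s)"
      using syndrome_less[of 0 _ m] by auto
    then have "card {w :: bool list. length w = ?b} = (\<Sum>s<?b. card (?L s))"
      using finL by (simp only:) (rule card_UN_disjoint, auto)
    then have "?b * 2 ^ ?b = (\<Sum>s<?b. card (?L s) * ?b)"
      using card by (simp add: sum_distrib_left mult.commute)
    also have "\<dots> > (\<Sum>s<?b. 2 ^ ?b)"
      by (rule sum_strict_mono) (use less in \<open>auto simp: lessThan_empty_iff\<close>)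
    finally show False by simp
  qed
  then obtain s where s: "s < ?b" "card (?L s) * ?b \<le> 2 ^ ?b" by blast
  obtain ws where ws: "set ws = ?L s" "distinct ws" using finite_distinct_list[OF finL] by blast
  then have len: "length ws = card (?L s)" using distinct_card by metis
  show thesis
  proof (rule that)
    show "1 \<le> ?b" by simp
    show "length w = ?b" if "w \<in> set ws" for w using that ws by auto
    show "\<exists>w\<in>set ws. card {j. j < ?b \<and> w ! j \<noteq> u ! j} \<le> 1" if u: "length u = ?b" for u
    proof -
      \<comment> \<open>Flipping position \<open>d\<close> moves the syndrome of \<open>u\<close> to
        \<open>s\<close>. If they agree already, then \<open>d = 0\<close>, and position 0 does not
        enter the syndrome.\<close>
      define d where "d = xor (syndrome 0 u) s"
      have d: "d < ?b" unfolding d_def using u s(1) by (intro xor_less_exp syndrome_less) auto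
      let ?w = "u[d := \<not> u ! d]"
      have "syndrome 0 ?w = s"
        using syndrome_flip[of d u 0] d u by (simp add: d_def xor.assoc xor.commute xor.left_commute)
      then have "?w \<in> set ws" using ws u by simp
      moreover have "{j. j < ?b \<and> ?w ! j \<noteq> u ! j} \<subseteq> {d}"
      proof (rule subsetI)
        fix j assume "j \<in> {j. j < ?b \<and> ?w ! j \<noteq> u ! j}"
        then have "?w ! j \<noteq> u ! j" by blast
        then show "j \<in> {d}" by (metis nth_list_update_neq singletonI)
      qed
      then have "card {j. j < ?b \<and> ?w ! j \<noteq> u ! j} \<le> card {d}" by (rule card_mono[rotated]) simp
      ultimately show ?thesis by auto
    qed
    show "length ws * K + 1 < 2 ^ ?b"
    proof (cases "length ws * K = 0")
      case True
      have "(2::nat) ^ 0 < 2 ^ ?b" by (rule power_strict_increasing) auto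
      then show ?thesis unfolding True by simp
    next
      case False
      have "length ws * Suc (2 * K) \<le> length ws * ?b" using m by (intro mult_le_mono2) simp
      also have "\<dots> \<le> 2 ^ ?b" using s(2) len by simp
      finally have "length ws + 2 * (length ws * K) \<le> 2 ^ ?b" by (simp add: algebra_simps)
      moreover have "0 < length ws" "0 < length ws * K" using False by auto
      ultimately show ?thesis by linarith
    qed
  qed
qed

section \<open>The main loop\<close>

text \<open>
  Variable 0 holds the instance, variable 1 a stack of lists of tasks, and variable 2 the answer.
  Stacking lists of tasks makes pushing all children of a task a constant-time operation.
\<close>

definition loop_body :: "(nat \<Rightarrow> com) \<Rightarrow> com" where
  "loop_body p = If (EHd (Var 1))
     (Seq (Assign 3 (ECons (Var 0) (EHd (EHd (Var 1))))) (Seq (p 3)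
       (If (EHd (Var 3)) (Seq (Assign 2 (ECons ENil ENil)) (Assign 1 ENil))
         (Assign 1 (ECons (ETl (Var 3)) (ECons (ETl (EHd (Var 1))) (ETl (Var 1))))))))
     (Assign 1 (ETl (Var 1)))"

text \<open>The potential charges 1 for each list on the stack and 2 for each unit of weight.
  Removing an empty list frees 1; expanding a task frees at least 2 and pays 1 for the pushed list
  of children; acceptance empties the stack. So the potential falls in every round, and a round
  takes time at most \<open>\<tau> + 40\<close>.\<close>

lemma exec_search_loop:
  fixes enc :: "'a \<Rightarrow> tree" and W :: "'a \<Rightarrow> nat"
  assumes p: "computes_within p F T"
    and F: "\<And>x. V x \<Longrightarrow> F (Pair D (enc x)) = Pair (enc_bool (acc x)) (enc_list enc (children x))"
    and V: "\<And>x y. V x \<Longrightarrow> y \<in> set (children x) \<Longrightarrow> V y"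
    and W: "\<And>x. V x \<Longrightarrow> 1 + (\<Sum>y\<leftarrow>children x. W y) \<le> W x"
    and T: "\<And>x. V x \<Longrightarrow> T (Pair D (enc x)) \<le> \<tau>"
    and sound: "\<And>x. V x \<Longrightarrow> acc x \<Longrightarrow> Q"
    and complete: "\<And>x. V x \<Longrightarrow> R x \<Longrightarrow> \<not> acc x \<Longrightarrow> \<exists>y\<in>set (children x). R y"
    and "\<forall>xs\<in>set xss. \<forall>x\<in>set xs. V x"
    and "s 0 = D" "s 1 = enc_list (enc_list enc) xss" "s 2 = Nil"
  shows "\<exists>t s'. exec (While (Var 1) (loop_body p)) s t s' \<and> (s' 2 \<noteq> Nil \<longrightarrow> Q) \<and>
    ((\<exists>xs\<in>set xss. \<exists>x\<in>set xs. R x) \<longrightarrow> s' 2 \<noteq> Nil) \<and>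
    t \<le> 2 + (\<Sum>xs\<leftarrow>xss. 1 + 2 * (\<Sum>x\<leftarrow>xs. W x)) * (\<tau> + 40)"
  using assms(8-)
proof (induction "\<Sum>xs\<leftarrow>xss. 1 + 2 * (\<Sum>x\<leftarrow>xs. W x)" arbitrary: xss s rule: less_induct)
  case less
  let ?\<mu> = "\<lambda>xss. \<Sum>xs\<leftarrow>xss. 1 + 2 * (\<Sum>x\<leftarrow>xs. W x)"
  let ?loop = "While (Var 1) (loop_body p)"
  note inv = less.prems
  consider "xss = []" | yss where "xss = [] # yss" | x xs yss where "xss = (x # xs) # yss"
    by (cases xss; cases "hd xss") auto
  then show ?case
  proof cases
    case 1
    then have "eval_expr (Var 1) s = Nil" using inv by simp
    from exec.WhileFalse[OF this] show ?thesis using 1 inv by (intro exI conjI) auto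
  next
    case (2 yss)
    let ?s = "s(1 := enc_list (enc_list enc) yss)"
    have ne: "eval_expr (Var 1) s \<noteq> Nil" and hd: "eval_expr (EHd (Var 1)) s = Nil" using inv 2 by simp_all
    have "exec (Assign 1 (ETl (Var 1))) s 3 ?s" by (rule exec_AssignI) (use inv 2 in simp_all)
    then have body: "exec (loop_body p) s 6 ?s"
      unfolding loop_body_def using exec.IfFalse[OF hd] by fastforce
    have lt: "?\<mu> yss < ?\<mu> xss" and eq: "?\<mu> xss = 1 + ?\<mu> yss" using 2 by simp_all
    have "\<exists>t s'. exec ?loop ?s t s' \<and> (s' 2 \<noteq> Nil \<longrightarrow> Q) \<and>
        ((\<exists>xs\<in>set yss. \<exists>x\<in>set xs. R x) \<longrightarrow> s' 2 \<noteq> Nil) \<and> t \<le> 2 + ?\<mu> yss * (\<tau> + 40)"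
      by (rule less.hyps[OF lt]) (use inv 2 in auto)
    then obtain t s' where t: "exec ?loop ?s t s'" "s' 2 \<noteq> Nil \<longrightarrow> Q"
      "(\<exists>xs\<in>set yss. \<exists>x\<in>set xs. R x) \<longrightarrow> s' 2 \<noteq> Nil" "t \<le> 2 + ?\<mu> yss * (\<tau> + 40)" by blast
    show ?thesis
      by (rule exI, rule exI[of _ s'], rule conjI[OF exec.WhileTrue[OF ne body t(1)]], unfold eq)
        (use 2 t(2-) in auto)
  next
    case (3 x xs yss)
    have Vx: "V x" using inv(1) 3 by simp
    let ?s1 = "s(3 := Pair D (enc x))"
    have ne: "eval_expr (Var 1) s \<noteq> Nil" and hd: "eval_expr (EHd (Var 1)) s \<noteq> Nil"
      using inv 3 by simp_all
    have e1: "exec (Assign 3 (ECons (Var 0) (EHd (EHd (Var 1))))) s 6 ?s1"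
      by (rule exec_AssignI) (use inv 3 in simp_all)
    \<comment> \<open>Base 3 keeps the instance, the stack and the answer out of reach of
      \<open>p\<close>.\<close>
    obtain t2 s2 where e2: "exec (p 3) ?s1 t2 s2" and s2: "s2 3 = F (?s1 3)" "\<forall>i<3. s2 i = ?s1 i"
      "t2 \<le> T (?s1 3)" by (rule computes_withinE[OF p])
    have s2: "s2 0 = D" "s2 1 = enc_list (enc_list enc) xss" "s2 2 = Nil"
      "s2 3 = Pair (enc_bool (acc x)) (enc_list enc (children x))" "t2 \<le> \<tau>"
      using s2 inv F[OF Vx] T[OF Vx] by auto
    show ?thesis
    proof (cases "acc x")
      case True
      let ?s3 = "s2(2 := Pair Nil Nil)"
      let ?s4 = "?s3(1 := Nil)"
      have hd3: "eval_expr (EHd (Var 3)) s2 \<noteq> Nil" using s2 True by simp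
      have e3: "exec (Assign 2 (ECons ENil ENil)) s2 4 ?s3" by (rule exec_AssignI) simp_all
      have e4: "exec (Assign 1 ENil) ?s3 2 ?s4" by (rule exec_AssignI) simp_all
      have body: "exec (loop_body p) s
          (1 + cost (EHd (Var 1)) + (6 + (t2 + (1 + cost (EHd (Var 3)) + (4 + 2))))) ?s4"
        unfolding loop_body_def
        by (rule exec.IfTrue[OF hd exec.Seq[OF e1 exec.Seq[OF e2 exec.IfTrue[OF hd3 exec.Seq[OF e3 e4]]]]])
      have "eval_expr (Var 1) ?s4 = Nil" by simp
      note exec.WhileTrue[OF ne body exec.WhileFalse[OF this]]
      moreover have "1 + cost (Var 1) + (1 + cost (EHd (Var 1)) + (6 + (t2 + (1 + cost (EHd (Var 3)) + (4 + 2))))) +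
          (1 + cost (Var 1)) \<le> 2 + ?\<mu> xss * (\<tau> + 40)" (is "?t \<le> _")
      proof -
        have "?t \<le> 2 + 1 * (\<tau> + 40)" using s2(5) by simp
        also have "\<dots> \<le> 2 + ?\<mu> xss * (\<tau> + 40)"
          by (intro add_left_mono mult_right_mono) (use 3 in simp_all)
        finally show ?thesis .
      qed
      moreover have "?s4 2 \<noteq> Nil" by simp
      moreover have Q using sound[OF Vx True] .
      ultimately show ?thesis by blast
    next
      case False
      let ?zss = "children x # xs # yss"
      let ?s3 = "s2(1 := enc_list (enc_list enc) ?zss)"
      have hd3: "eval_expr (EHd (Var 3)) s2 = Nil" using s2 False by simp
      have e3: "exec (Assign 1 (ECons (ETl (Var 3)) (ECons (ETl (EHd (Var 1))) (ETl (Var 1))))) s2 10 ?s3"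
        by (rule exec_AssignI) (use s2 3 in simp_all)
      have body: "exec (loop_body p) s
          (1 + cost (EHd (Var 1)) + (6 + (t2 + (1 + cost (EHd (Var 3)) + 10)))) ?s3"
        unfolding loop_body_def
        by (rule exec.IfTrue[OF hd exec.Seq[OF e1 exec.Seq[OF e2 exec.IfFalse[OF hd3 e3]]]])
      have lt: "1 + ?\<mu> ?zss \<le> ?\<mu> xss" using W[OF Vx] 3 by simp
      have "\<exists>t s'. exec ?loop ?s3 t s' \<and> (s' 2 \<noteq> Nil \<longrightarrow> Q) \<and>
          ((\<exists>xs\<in>set ?zss. \<exists>x\<in>set xs. R x) \<longrightarrow> s' 2 \<noteq> Nil) \<and> t \<le> 2 + ?\<mu> ?zss * (\<tau> + 40)"
        by (rule less.hyps) (use lt inv 3 s2 V[OF Vx] in auto)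
      then obtain t s' where t: "exec ?loop ?s3 t s'" "s' 2 \<noteq> Nil \<longrightarrow> Q"
        "(\<exists>xs\<in>set ?zss. \<exists>x\<in>set xs. R x) \<longrightarrow> s' 2 \<noteq> Nil" "t \<le> 2 + ?\<mu> ?zss * (\<tau> + 40)" by blast
      note exec.WhileTrue[OF ne body t(1)]
      moreover have "1 + cost (Var 1) + (1 + cost (EHd (Var 1)) + (6 + (t2 + (1 + cost (EHd (Var 3)) + 10)))) + t
          \<le> 2 + ?\<mu> xss * (\<tau> + 40)" (is "?t \<le> _")
      proof -
        have "?t \<le> 2 + ((\<tau> + 40) + ?\<mu> ?zss * (\<tau> + 40))" using s2(5) t(4) by simp
        also have "\<dots> = 2 + (1 + ?\<mu> ?zss) * (\<tau> + 40)" by simp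
        also have "\<dots> \<le> 2 + ?\<mu> xss * (\<tau> + 40)"
          by (intro add_left_mono mult_right_mono lt) simp
        finally show ?thesis .
      qed
      moreover have "(\<exists>xs\<in>set xss. \<exists>x\<in>set xs. R x) \<longrightarrow> (\<exists>xs\<in>set ?zss. \<exists>x\<in>set xs. R x)"
        using complete[OF Vx _ False] 3 by auto
      ultimately show ?thesis using t(2,3) by blast
    qed
  qed
qed

section \<open>Running time\<close>

lemma tsize_enc_nat [simp]: "tsize (enc_nat n) = 2 * n + 1"
  by (induction n) auto

lemma tsize_enc_list_le:
  assumes "\<And>x. x \<in> set xs \<Longrightarrow> tsize (f x) \<le> M"
  shows "tsize (enc_list f xs) \<le> 1 + length xs * (M + 1)"
  using assms
proof (induction xs)
  case (Cons x xs)
  then have "tsize (f x) \<le> M" "tsize (enc_list f xs) \<le> 1 + length xs * (M + 1)" by auto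
  then show ?case by simp
qed simp

lemma tsize_enc_constraint_le:
  assumes "wf_constraint C" "set (fst C) \<subseteq> {..<s}" "length (fst C) \<le> s" "length (snd C) \<le> s"
  shows "tsize (enc_constraint C) \<le> 3 + 4 * s + 6 * s ^ 2"
proof -
  obtain vs ts where C: "C = (vs, ts)" by (cases C)
  have "tsize (enc_list enc_nat vs) \<le> 1 + length vs * (2 * s + 1)"
    using tsize_enc_list_le[of vs enc_nat "2 * s"] assms(2) C by force
  also have "\<dots> \<le> 1 + s * (2 * s + 1)" using assms(3) C by (intro add_left_mono mult_right_mono) auto
  finally have 1: "tsize (enc_list enc_nat vs) \<le> 1 + s * (2 * s + 1)" .
  have "tsize (enc_list enc_bool t) \<le> 1 + s * 4" if "t \<in> set ts" for t
  proof -
    have "length t \<le> s" using assms(1,3) that C by (auto simp: wf_constraint_def)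
    then show ?thesis using tsize_enc_list_le[of t enc_bool 3] by (simp add: le_trans)
  qed
  then have "tsize (enc_list (enc_list enc_bool) ts) \<le> 1 + length ts * (1 + s * 4 + 1)"
    by (rule tsize_enc_list_le)
  also have "\<dots> \<le> 1 + s * (1 + s * 4 + 1)" using assms(4) C by (intro add_left_mono mult_right_mono) auto
  finally show ?thesis using 1 C by (simp add: enc_constraint_def power2_eq_square algebra_simps)
qed

text \<open>A constraint with unary names has size quadratic in the instance size, and there are at
  most linearly many constraints: the source of the cube.\<close>

lemma tsize_enc_instance_le:
  assumes "\<And>C. C \<in> set (snd I) \<Longrightarrow> wf_constraint C \<and> set (fst C) \<subseteq> {..<fst I}"
  shows "tsize (enc_instance I) \<le> 20 * instance_size I ^ 3"
proof -
  obtain n Cs where I: "I = (n, Cs)" by (cases I)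
  let ?s = "instance_size I"
  let ?w = "\<lambda>C. (1 + length (fst C)) * (1 + length (snd C))"
  have s: "?s = 1 + n + (\<Sum>C\<leftarrow>Cs. ?w C)"
    by (simp add: instance_size_def I case_prod_unfold)
  have "(\<Sum>C\<leftarrow>Cs. 1) \<le> (\<Sum>C\<leftarrow>Cs. ?w C)" by (rule sum_list_mono) simp
  then have Cs: "length Cs \<le> ?s" using s by (simp add: sum_list_triv)
  have "tsize (enc_constraint C) \<le> 3 + 4 * ?s + 6 * ?s ^ 2" if C: "C \<in> set Cs" for C
  proof (rule tsize_enc_constraint_le)
    have "?w C \<le> (\<Sum>C\<leftarrow>Cs. ?w C)" using C by (intro member_le_sum_list) auto
    moreover have "length (fst C) \<le> ?w C" "length (snd C) \<le> ?w C" by simp_all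
    ultimately show "length (fst C) \<le> ?s" "length (snd C) \<le> ?s" using s by linarith+
    have "n \<le> ?s" using s by simp
    then show "set (fst C) \<subseteq> {..<?s}" "wf_constraint C" using assms[of C] C I by auto
  qed
  then have "tsize (enc_list enc_constraint Cs) \<le> 1 + length Cs * (3 + 4 * ?s + 6 * ?s ^ 2 + 1)"
    by (rule tsize_enc_list_le)
  also have "\<dots> \<le> 1 + ?s * (3 + 4 * ?s + 6 * ?s ^ 2 + 1)" using Cs by (intro add_left_mono mult_right_mono) auto
  finally have L: "tsize (enc_list enc_constraint Cs) \<le> 1 + ?s * (3 + 4 * ?s + 6 * ?s ^ 2 + 1)" .
  have "n \<le> ?s" using s by simp
  moreover have "tsize (enc_instance I) = 1 + (2 * n + 1) + tsize (enc_list enc_constraint Cs)"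
    by (simp add: enc_instance_def I)
  ultimately have "tsize (enc_instance I) \<le> 1 + (2 * ?s + 1) + (1 + ?s * (3 + 4 * ?s + 6 * ?s ^ 2 + 1))"
    using L by linarith
  also have "\<dots> = 3 + 6 * ?s + 4 * ?s ^ 2 + 6 * ?s ^ 3"
    by (simp add: algebra_simps power2_eq_square power3_eq_cube)
  also have "\<dots> \<le> 3 * ?s ^ 3 + 6 * ?s ^ 3 + 4 * ?s ^ 3 + 6 * ?s ^ 3"
  proof -
    have "1 \<le> ?s" using s by simp
    then have "?s ^ 1 \<le> ?s ^ 3" "?s ^ 2 \<le> ?s ^ 3" "1 \<le> ?s ^ 3"
      by (intro power_increasing | simp)+
    then show ?thesis by simp
  qed
  finally show ?thesis by simp
qed

text \<open>The nested \<open>ECons\<close> writes out the stack whose only list consists of the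
  task \<open>([], 0, 0)\<close>; its budget 0 is stored as a unary 1.\<close>

definition search_program :: "(nat \<Rightarrow> com) \<Rightarrow> com" where
  "search_program p = Seq (Assign 2 ENil)
     (Seq (Assign 1 (ECons (ECons (ECons ENil (ECons (ECons ENil ENil) ENil)) ENil) ENil))
     (Seq (While (Var 1) (loop_body p)) (Assign 0 (Var 2))))"

context search
begin

lemma tsize_enc_task_le:
  assumes "valid T"
  shows "tsize (enc_task T) \<le> 20 * (fst I + b) ^ 2"
proof -
  obtain a \<rho> v where T: "T = (a, \<rho>, v)" by (cases T)
  from assms[unfolded T] obtain "is" f where a: "a = lits is f" "distinct is" "set is = {..<v}"
    and v: "v < fst I + b" "\<rho> \<le> v"
    by (rule validE)
  define u where "u = fst I + b"
  have len: "length a = v" using distinct_card[OF a(2)] a by (simp add: lits_def)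
  have "tsize (enc_lit p) \<le> 2 * u + 5" if p: "p \<in> set a" for p
  proof -
    obtain i c where ic: "p = (i, c)" by (cases p)
    have "i < v" using p ic a by auto
    then have "2 * i \<le> 2 * u" using v(1) by (simp add: u_def)
    moreover have "tsize (enc_bool c) \<le> 3" by (rule enc_bool_simps(4))
    ultimately show ?thesis unfolding enc_lit_def ic prod.case tsize.simps tsize_enc_nat by linarith
  qed
  then have "tsize (enc_lits a) \<le> 1 + v * (2 * u + 5 + 1)"
    using tsize_enc_list_le[of a enc_lit "2 * u + 5"] len by simp
  also have "\<dots> \<le> 1 + u * (2 * u + 5 + 1)"
    using v(1) by (intro add_left_mono mult_right_mono) (auto simp: u_def)
  finally have "tsize (enc_task T) \<le> 7 + 10 * u + 2 * u ^ 2"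
    using v by (simp add: enc_task_def T u_def power2_eq_square algebra_simps)
  also have "\<dots> \<le> 7 * u ^ 2 + 10 * u ^ 2 + 2 * u ^ 2"
  proof -
    have "1 \<le> u" using b by (simp add: u_def)
    then have "u ^ 1 \<le> u ^ 2" "1 \<le> u ^ 2" by (intro power_increasing | simp)+
    then show ?thesis by simp
  qed
  finally show ?thesis by (simp add: u_def)
qed

lemma exec_search_program:
  assumes p: "computes_within p (branch_tree b ws) T"
    and \<tau>: "\<And>x. valid x \<Longrightarrow> T (Pair (enc_instance I) (enc_task x)) \<le> \<tau>"
  shows "\<exists>t s. exec (search_program p) (init_state (enc_instance I)) t s \<and>
    (s 0 \<noteq> Nil \<longleftrightarrow> satisfiable I) \<and> t \<le> 18 + (1 + 2 * weight ([], 0, 0)) * (\<tau> + 40)"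
proof -
  let ?s0 = "init_state (enc_instance I)"
  let ?s1 = "?s0(2 := Nil)"
  let ?s2 = "?s1(1 := enc_list (enc_list enc_task) [[([], 0, 0)]])"
  let ?init = "([], 0, 0) :: task"
  have V0: "valid ?init" using b valid_lits[of "[]" 0 0] by (simp add: lits_def)
  have R0: "promising ?init \<longleftrightarrow> satisfiable I"
    unfolding satisfiable_iff by (simp add: promising_def flips_def)
  have e1: "exec (Assign 2 ENil) ?s0 2 ?s1" by (rule exec_AssignI) simp_all
  have e2: "exec (Assign 1 (ECons (ECons (ECons ENil (ECons (ECons ENil ENil) ENil)) ENil) ENil)) ?s1 12 ?s2"
    by (rule exec_AssignI) (simp_all add: enc_task_def)
  have wf: "\<forall>C\<in>set (snd I). wf_constraint C" using inst_constraint(3) by blast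
  have "\<exists>t s'. exec (While (Var 1) (loop_body p)) ?s2 t s' \<and> (s' 2 \<noteq> Nil \<longrightarrow> satisfiable I) \<and>
      ((\<exists>xs\<in>set [[?init]]. \<exists>x\<in>set xs. promising x) \<longrightarrow> s' 2 \<noteq> Nil) \<and>
      t \<le> 2 + (\<Sum>xs\<leftarrow>[[?init]]. 1 + 2 * (\<Sum>x\<leftarrow>xs. weight x)) * (\<tau> + 40)"
  proof (rule exec_search_loop[where V = valid and acc = "\<lambda>x. fst (branch b ws I x)"
        and children = "\<lambda>x. snd (branch b ws I x)" and D = "enc_instance I" and enc = enc_task,
        OF p branch_tree_enc[OF wf]])
    show "?s2 0 = enc_instance I" by (simp add: init_state_def)
  qed (use branch_valid branch_weight \<tau> accept_imp_satisfiable branch_promising V0 in auto)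
  then obtain t s' where t: "exec (While (Var 1) (loop_body p)) ?s2 t s'" "s' 2 \<noteq> Nil \<longrightarrow> satisfiable I"
    "promising ?init \<longrightarrow> s' 2 \<noteq> Nil" "t \<le> 2 + (1 + 2 * weight ?init) * (\<tau> + 40)"
    by auto
  have e3: "exec (Assign 0 (Var 2)) s' 2 (s'(0 := s' 2))" by (rule exec_AssignI) simp_all
  have "exec (search_program p) ?s0 (2 + (12 + (t + 2))) (s'(0 := s' 2))"
    unfolding search_program_def by (rule exec.Seq[OF e1 exec.Seq[OF e2 exec.Seq[OF t(1) e3]]])
  moreover have "2 + (12 + (t + 2)) \<le> 18 + (1 + 2 * weight ?init) * (\<tau> + 40)" using t(4) by linarith
  moreover have "(s'(0 := s' 2)) 0 \<noteq> Nil \<longleftrightarrow> satisfiable I"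
    unfolding fun_upd_same using t(2,3) R0 by blast
  ultimately show ?thesis by blast
qed

end

text \<open>Rounding up the number of blocks costs a single additional factor \<open>B\<close>,
  which is constant in the final bound.\<close>

lemma power_ceil_div_le:
  fixes B :: real
  assumes "1 \<le> B" "1 \<le> b"
  shows "B ^ ((n + b - 1) div b) \<le> B * (B powr (1 / b)) ^ n"
proof -
  have "real ((n + b - 1) div b) \<le> real (n + b - 1) / b" by (rule of_nat_div_le_of_nat)
  also have "\<dots> \<le> real (n + b) / b" by (intro divide_right_mono) auto
  also have "\<dots> = real n / b + 1" using assms(2) by (simp add: add_divide_distrib)
  finally have "B powr real ((n + b - 1) div b) \<le> B powr (real n / b + 1)"
    using assms(1) by (rule powr_mono)
  also have "\<dots> = B * (B powr (1 / b)) ^ n"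
    using assms(1) by (simp add: powr_add powr_powr flip: powr_realpow)
  finally show ?thesis using assms(1) by (simp add: powr_realpow)
qed

theorem theorem13:
  fixes k :: nat
  assumes "k \<ge> 3"
    and "sunflower_conjecture k"
  shows "\<exists>c::real. c < 2 \<and> explicit_SAT_solvable_in_O_star (Inv k (nu k)) c"
proof -
  obtain C :: real where C: "\<forall>n\<ge>1. \<forall>F :: nat set set. finite F \<longrightarrow>
      (\<forall>A\<in>F. finite A \<and> card A = n) \<longrightarrow> C ^ n \<le> real (card F) \<longrightarrow> (\<exists>S\<subseteq>F. sunflower k S)"
    using assms(2) unfolding sunflower_conjecture_def by (rule exE)
  \<comment> \<open>The constant of the conjecture may be negative or fractional; raising it to a
    natural number only shrinks the class of families concerned.\<close>
  define c where "c = max 1 (nat \<lceil>\<bar>C\<bar>\<rceil>)"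
  have c1: "1 \<le> c" unfolding c_def by (rule max.cobounded1)
  have "\<bar>C\<bar> \<le> real (nat \<lceil>\<bar>C\<bar>\<rceil>)" by (rule real_nat_ceiling_ge)
  also have "\<dots> \<le> real c" unfolding c_def by (intro of_nat_mono max.cobounded2)
  finally have absC: "\<bar>C\<bar> \<le> real c" .
  have Cc: "C ^ n \<le> real (c ^ n)" for n
  proof -
    have "C ^ n \<le> \<bar>C\<bar> ^ n" by (metis abs_ge_self power_abs)
    also have "\<dots> \<le> real c ^ n" by (rule power_mono[OF absC]) simp
    finally show ?thesis by simp
  qed
  have sun: "\<exists>S\<subseteq>F. sunflower k S" if "1 \<le> d" "finite F" "\<forall>A\<in>F. finite A \<and> card A = d" "c ^ d \<le> card F"
    for d and F :: "nat set set"
  proof -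
    have "real (c ^ d) \<le> real (card F)" using that(4) by (rule of_nat_mono)
    with Cc[of d] have "C ^ d \<le> real (card F)" by (rule order_trans)
    then show ?thesis using C that(1-3) by (simp only: simp_thms)
  qed
  obtain b and ws :: "bool list list" where b: "1 \<le> b" and len: "\<And>w. w \<in> set ws \<Longrightarrow> length w = b"
    and cov: "\<And>u. length u = b \<Longrightarrow> \<exists>w\<in>set ws. card {j. j < b \<and> w ! j \<noteq> u ! j} \<le> 1"
    and few: "length ws * (2 * c) + 1 < 2 ^ b"
    using ex_covering_code[of "2 * c"] by blast
  obtain T p where T: "poly_bounded T" and p: "computes_within p (branch_tree b ws) T"
    by (rule ptimeE[OF ptime_branch_tree])
  obtain e where e: "\<And>x. T x \<le> (1 + tsize x) ^ e" using T unfolding poly_bounded_def by blast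
  define B where "B = length ws * (2 * c) + 1"
  define c0 where "c0 = real B powr (1 / b)"
  \<comment> \<open>Collects the size of the argument of the branching step, in units of the cubed
    instance size: 20 for the instance, \<open>20 * (1 + b) ^ 2\<close> for the task, and 2 for the
    pair node and the summand 1.\<close>
  define A where "A = 22 + 20 * (1 + b) ^ 2"
  have "real B < real (2 ^ b)" using few unfolding B_def by (rule of_nat_less_iff[THEN iffD2])
  then have "c0 < (2 ^ b) powr (1 / b)" unfolding c0_def using b by (intro powr_less_mono2) auto
  also have "\<dots> = 2" using b by (simp add: powr_powr flip: powr_realpow)
  finally have "c0 < 2" .
  have B1: "1 \<le> real B" by (simp add: B_def)
  then have c01: "1 \<le> c0" unfolding c0_def by (intro ge_one_powr_ge_zero) auto
  have "decides_within (search_program p) (SAT_instances (Inv k (nu k)))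
    (\<lambda>I. real ((18 + 123 * B) * A ^ e * instance_size I ^ (3 * e)) * c0 ^ num_vars I)"
    unfolding decides_within_def
  proof
    fix I assume inst: "I \<in> SAT_instances (Inv k (nu k))"
    interpret search k c b ws I
      by unfold_locales (use assms(1) c1 b sun len cov inst in auto)
    let ?s = "instance_size I"
    have s: "1 \<le> ?s" "fst I \<le> ?s" by (auto simp: instance_size_def case_prod_unfold)
    define \<tau> where "\<tau> = A ^ e * ?s ^ (3 * e)"
    have \<tau>1: "1 \<le> \<tau>" using s by (simp add: \<tau>_def A_def Suc_le_eq)
    have \<tau>: "T (Pair (enc_instance I) (enc_task x)) \<le> \<tau>" if "valid x" for x
    proof -
      have "b * 1 \<le> b * ?s" using s(1) by (rule mult_le_mono2)
      then have "fst I + b \<le> (1 + b) * ?s" using s(2) unfolding distrib_right mult_1_left mult_1_right by linarith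
      then have "20 * (fst I + b) ^ 2 \<le> 20 * ((1 + b) * ?s) ^ 2" by (intro mult_left_mono power_mono) auto
      also have "\<dots> = 20 * (1 + b) ^ 2 * ?s ^ 2" by (simp only: power_mult_distrib mult.assoc)
      also have "\<dots> \<le> 20 * (1 + b) ^ 2 * ?s ^ 3"
        using s(1) by (intro mult_left_mono power_increasing) auto
      finally have "tsize (enc_task x) \<le> 20 * (1 + b) ^ 2 * ?s ^ 3"
        using tsize_enc_task_le[OF that] by linarith
      moreover have "tsize (enc_instance I) \<le> 20 * ?s ^ 3"
        by (rule tsize_enc_instance_le) (use inst_constraint in auto)
      moreover have "1 \<le> ?s ^ 3" using s(1) by simp
      ultimately have "1 + tsize (Pair (enc_instance I) (enc_task x)) \<le>
          2 * ?s ^ 3 + 20 * ?s ^ 3 + 20 * (1 + b) ^ 2 * ?s ^ 3"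
        unfolding tsize.simps by linarith
      also have "\<dots> = A * ?s ^ 3" by (simp add: A_def algebra_simps)
      finally have "(1 + tsize (Pair (enc_instance I) (enc_task x))) ^ e \<le> (A * ?s ^ 3) ^ e"
        by (rule power_mono) simp
      also have "\<dots> = \<tau>" by (simp add: \<tau>_def power_mult_distrib power_mult)
      finally show ?thesis using e le_trans by blast
    qed
    obtain t s' where t: "exec (search_program p) (init_state (enc_instance I)) t s'"
      "s' 0 \<noteq> Nil \<longleftrightarrow> satisfiable I" "t \<le> 18 + (1 + 2 * weight ([], 0, 0)) * (\<tau> + 40)"
      using exec_search_program[OF p \<tau>] by blast
    have W: "weight ([], 0, 0) = B ^ ((fst I + b - 1) div b)" by (simp add: weight_def B_def)
    have le: "real B ^ ((fst I + b - 1) div b) \<le> B * c0 ^ fst I"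
      unfolding c0_def by (rule power_ceil_div_le[OF B1 b])
    have cn: "1 \<le> c0 ^ fst I" using c01 by simp
    have Bc: "1 \<le> B * c0 ^ fst I" using mult_mono[OF B1 cn] B1 by simp
    have "real t \<le> real (18 + (1 + 2 * weight ([], 0, 0)) * (\<tau> + 40))" using t(3) of_nat_mono by blast
    also have "\<dots> = 18 + (1 + 2 * real B ^ ((fst I + b - 1) div b)) * (\<tau> + 40)" by (simp add: W algebra_simps)
    \<comment> \<open>Since \<open>\<tau>\<close> and \<open>B * c0 ^ fst I\<close> are at least 1,
      sums turn into products: the weight term contributes a factor 3 and \<open>\<tau> + 40\<close>
      a factor 41, whence \<open>123 * B\<close>.\<close>
    also have "\<dots> \<le> 18 * (\<tau> * c0 ^ fst I) + (3 * (B * c0 ^ fst I)) * (41 * \<tau>)"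
    proof (intro add_mono mult_mono)
      have "1 * 1 \<le> real \<tau> * c0 ^ fst I" using \<tau>1 cn by (intro mult_mono) auto
      then show "18 \<le> 18 * (\<tau> * c0 ^ fst I)" by simp
    qed (use le Bc \<tau>1 in auto)
    also have "\<dots> = real ((18 + 123 * B) * A ^ e * ?s ^ (3 * e)) * c0 ^ num_vars I"
      by (simp add: \<tau>_def num_vars_def algebra_simps)
    finally show "\<exists>t s. exec (search_program p) (init_state (enc_instance I)) t s \<and>
        (s 0 \<noteq> Nil \<longleftrightarrow> satisfiable I) \<and>
        real t \<le> real ((18 + 123 * B) * A ^ e * instance_size I ^ (3 * e)) * c0 ^ num_vars I"
      using t(1,2) by blast
  qed
  then have "explicit_SAT_solvable_in_O_star (Inv k (nu k)) c0"
    unfolding explicit_SAT_solvable_in_O_star_def by blast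
  with \<open>c0 < 2\<close> show ?thesis by blast
qed

end
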